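(* Let $n\ge1$ be an integer, $0\le\varepsilon\le\arccos\sqrt{2/3}$, and $f(\varepsilon)=\tfrac12\left(1+\cos\varepsilon-\sqrt2\,\sin\varepsilon\right)$. Let $\tau=\bigotimes_{j=1}^n\tau^{(j)}$ be any $n$-qubit product state and let $\hat n_k^{(j)}\in\mathbb{R}^3$ ($k=1,2,3$, $j=1,\dots,n$) be any unit vectors with $\hat n^{(j)}_k\cdot\hat e_k\ge\cos\varepsilon$, where $\hat e_1,\hat e_2,\hat e_3$ is the standard basis of $\mathbb{R}^3$. Then the state $\rho$ obtained by maximum-likelihood reconstruction from the data generated by measuring $\hat n_k^{(j)}\cdot\vec\sigma$, while presuming that the Pauli observables were measured (as defined in the context), satisfies $$\mathcal F\Big(\bigotimes_{j=1}^n\tau^{(j)},\rho\Big)\ \ge\ f_n(\varepsilon):=[f(\varepsilon)]^n .$$ The inequality is saturated when every $\tau^{(j)}$ is the pure state with Bloch vector $\hat s=\frac1{\sqrt3}(1,1,1)$ and, for every $j$, $\hat n_1^{(j)}=(\cos\varepsilon,-\tfrac{\sin\varepsilon}{\sqrt2},-\tfrac{\sin\varepsilon}{\sqrt2})$, $\hat n_2^{(j)}=(-\tfrac{\sin\varepsilon}{\sqrt2},\cos\varepsilon,-\tfrac{\sin\varepsilon}{\sqrt2})$, $\hat n_3^{(j)}=(-\tfrac{\sin\varepsilon}{\sqrt2},-\tfrac{\sin\varepsilon}{\sqrt2},\cos\varepsilon)$. Moreover $\frac{\partial f_n}{\partial\varepsilon}\big|_{\varepsilon\to0}=-\frac{n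}{\sqrt2}$.
   Context: $\vec\sigma=(\sigma_x,\sigma_y,\sigma_z)$ is the vector of Pauli matrices; a qubit state with Bloch vector $\vec t$ ($\|\vec t\|\le1$) is $\frac12(\mathbb 1+\vec t\cdot\vec\sigma)$. The fidelity of density matrices is $\mathcal F(\tau,\rho)=\left(\mathrm{tr}\sqrt{\sqrt\tau\,\rho\,\sqrt\tau}\right)^2$. Data: each of the $n$ qubits $j$ is measured in one of three settings $k_j\in\{1,2,3\}$. The intended observables are $M_1^{(j)}=\sigma_x$, $M_2^{(j)}=\sigma_y$, $M_3^{(j)}=\sigma_z$; those actually measured are $N_k^{(j)}=\hat n_k^{(j)}\cdot\vec\sigma$. There is no statistical error, so for every setting $\mathbf k=(k_1,\dots,k_n)\in\{1,2,3\}^n$ and outcome string $\mathbf a\in\{\pm1\}^n$ the data are the exact probabilities $$P(\mathbf a|\mathbf k)=\mathrm{tr}\Big[\tau\bigotimes_{j=1}^n\tfrac{\mathbb 1+a_jN^{(j)}_{k_j}}{2}\Big].$$ Maximum-likelihood reconstruction: $\rho$ is the $n$-qubit density matrix maximizing, over all $n$-qubit density matrices, $$\log\mathcal L(\rho)=\sum_{\mathbf k}\sum_{\mathbf a}P(\mathbf a|\mathbf k)\,\log\mathrm{tr}\Big[\rho\bigotimes_{j=1}^n\tfrac{\mathbb 1+a_jM^{(j)}_{k_j}}{2}\Big],$$ with the conventions $0\log 0=0$ and $\log0=-\infty$. *)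

theory Defs
  imports "HOL-Analysis.Analysis"
begin

text \<open>Operators on a \<open>d\<close>-dimensional Hilbert space are matrices \<open>complex^'d^'d\<close> with \<open>CARD('d) = d\<close>.\<close>

definition adjoint_mat :: "complex^'d^'d \<Rightarrow> complex^'d^'d" where
  "adjoint_mat A = (\<chi> i j. cnj (A $ j $ i))"

definition psd_mat :: "complex^'d^'d \<Rightarrow> bool" where
  "psd_mat A \<longleftrightarrow> adjoint_mat A = A \<and>
     (\<forall>v :: complex^'d. 0 \<le> Re (\<Sum>i\<in>UNIV. cnj (v $ i) * (A *v v) $ i))"

definition density_mat :: "complex^'d^'d \<Rightarrow> bool" where
  "density_mat \<rho> \<longleftrightarrow> psd_mat \<rho> \<and> trace \<rho> = 1"

text \<open>The positive semidefinite square root, meaningful for positive semidefinite arguments only.\<close>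

definition sqrt_mat :: "complex^'d^'d \<Rightarrow> complex^'d^'d" where
  "sqrt_mat A = (THE B. psd_mat B \<and> B ** B = A)"

definition fidelity :: "complex^'d^'d \<Rightarrow> complex^'d^'d \<Rightarrow> real" where
  "fidelity \<tau> \<rho> = (Re (trace (sqrt_mat (sqrt_mat \<tau> ** \<rho> ** sqrt_mat \<tau>))))\<^sup>2"

definition sigma_x :: "complex^2^2" where
  "sigma_x = vector [vector [0, 1], vector [1, 0]]"

definition sigma_y :: "complex^2^2" where
  "sigma_y = vector [vector [0, - \<i>], vector [\<i>, 0]]"

definition sigma_z :: "complex^2^2" where
  "sigma_z = vector [vector [1, 0], vector [0, - 1]]"

text \<open>The type \<open>3\<close> of settings has the elements \<open>1\<close>, \<open>2\<close> and \<open>3\<close> (where \<open>3 = 0\<close>).\<close>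

definition pauli :: "3 \<Rightarrow> complex^2^2" where
  "pauli k = (if k = 1 then sigma_x else if k = 2 then sigma_y else sigma_z)"

definition dot_sigma :: "real^3 \<Rightarrow> complex^2^2" where
  "dot_sigma t = (\<Sum>k\<in>UNIV. (t $ k) *\<^sub>R pauli k)"

definition bloch_state :: "real^3 \<Rightarrow> complex^2^2" where
  "bloch_state t = (1 / 2) *\<^sub>R (mat 1 + dot_sigma t)"

text \<open>The projector onto outcome \<open>a = \<plusminus>1\<close> of an observable with eigenvalues \<open>\<plusminus>1\<close>.\<close>

definition outcome_proj :: "real \<Rightarrow> complex^2^2 \<Rightarrow> complex^2^2" where
  "outcome_proj a N = (1 / 2) *\<^sub>R (mat 1 + a *\<^sub>R N)"

text \<open>
  The qubits are indexed by a finite type \<open>'n\<close>, so that their number \<open>n = CARD('n) \<ge> 1\<close> is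
  arbitrary. The computational basis vectors of the \<open>n\<close>-qubit space are the functions
  \<open>'n \<Rightarrow> 2\<close>, and the entry of a tensor product of operators at \<open>(x, y)\<close> is the product of
  the entries of the factors at \<open>(x j, y j)\<close>.
\<close>

type_synonym 'n multi_op = "complex^('n \<Rightarrow> 2)^('n \<Rightarrow> 2)"

definition tensor :: "('n::finite \<Rightarrow> complex^2^2) \<Rightarrow> 'n multi_op" where
  "tensor A = (\<chi> x y. \<Prod>j\<in>UNIV. A j $ x j $ y j)"

definition outcomes :: "('n::finite \<Rightarrow> real) set" where
  "outcomes = {a. \<forall>j. a j \<in> {1, - 1}}"

text \<open>
  Probability of the outcomes \<open>a\<close> under the settings \<open>k\<close> in the state \<open>\<rho>\<close>, if setting \<open>i\<close> of
  qubit \<open>j\<close> measures \<open>N j i\<close>. The trace is real for Hermitian arguments.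
\<close>

definition outcome_prob ::
  "('n::finite \<Rightarrow> 3 \<Rightarrow> complex^2^2) \<Rightarrow> 'n multi_op \<Rightarrow> ('n \<Rightarrow> 3) \<Rightarrow> ('n \<Rightarrow> real) \<Rightarrow> real" where
  "outcome_prob N \<rho> k a = Re (trace (\<rho> ** tensor (\<lambda>j. outcome_proj (a j) (N j (k j)))))"

definition log_ext :: "real \<Rightarrow> ereal" where
  "log_ext x = (if x > 0 then ereal (ln x) else - \<infinity>)"

text \<open>The convention \<open>0 log 0 = 0\<close> is that of multiplication on \<open>ereal\<close>, where \<open>0 * (- \<infinity>) = 0\<close>.\<close>

definition log_likelihood ::
  "(('n::finite \<Rightarrow> 3) \<Rightarrow> ('n \<Rightarrow> real) \<Rightarrow> real) \<Rightarrow> 'n multi_op \<Rightarrow> ereal" where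
  "log_likelihood P \<rho> =
     (\<Sum>k\<in>UNIV. \<Sum>a\<in>outcomes. ereal (P k a) * log_ext (outcome_prob (\<lambda>j. pauli) \<rho> k a))"

definition is_ml_state ::
  "(('n::finite \<Rightarrow> 3) \<Rightarrow> ('n \<Rightarrow> real) \<Rightarrow> real) \<Rightarrow> 'n multi_op \<Rightarrow> bool" where
  "is_ml_state P \<rho> \<longleftrightarrow> density_mat \<rho> \<and>
     (\<forall>\<rho>'. density_mat \<rho>' \<longrightarrow> log_likelihood P \<rho>' \<le> log_likelihood P \<rho>)"

definition measured_data ::
  "('n::finite \<Rightarrow> 3 \<Rightarrow> real^3) \<Rightarrow> 'n multi_op \<Rightarrow> ('n \<Rightarrow> 3) \<Rightarrow> ('n \<Rightarrow> real) \<Rightarrow> real" where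
  "measured_data nhat \<tau> = outcome_prob (\<lambda>j k. dot_sigma (nhat j k)) \<tau>"

definition fid_bound :: "real \<Rightarrow> real" where
  "fid_bound e = (1 / 2) * (1 + cos e - sqrt 2 * sin e)"

definition fid_bound_n :: "nat \<Rightarrow> real \<Rightarrow> real" where
  "fid_bound_n n e = (fid_bound e) ^ n"

end

(*
  Since the data of a product state factorize, so does the reconstruction. In one qubit with
  Bloch vector t the data are the numbers f_k = n_k . t, and the reconstructed Bloch vector r is f
  itself if f lies in the unit ball, and a unit vector with r_k f_k >= r_k^2 otherwise (Lagrange
  condition). The operator R = sum P / tr(rho Pi) Pi of one qubit satisfies 0 <= R <= 3, hence the
  tensor product of these operators is at most 3^n, and ln x <= x - 1 turns this into global
  optimality of the product state. Equality forces equal probabilities wherever P > 0. At most one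
  setting per qubit has a deterministic outcome, so these projectors span all operators and the
  maximizer is unique.

  The fidelity is multiplicative and for one qubit equals
  (1 + t.r + sqrt((1 - |t|^2) (1 - |r|^2))) / 2. As the angle between n_k and e_k is at most eps,
  t_k >= cos(eps) f_k - sin(eps) sqrt(|t|^2 - f_k^2) for f_k >= 0, and likewise with t_k and f_k
  exchanged. Multiplying by r_k and summing, Cauchy-Schwarz gives the factor sqrt 2, through
  sum |r_k| sqrt(1 - r_k^2) <= sqrt 2 for a unit vector r.
*)

theory Submission
  imports Defs
begin

section \<open>Positive semidefinite matrices\<close>

text \<open>The complex-valued Hermitian form; \<open>inner\<close> on \<open>complex^'d\<close>
  gives only its real part.\<close>

definition cdot :: "complex^'d \<Rightarrow> complex^'d \<Rightarrow> complex" where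
  "cdot u w = (\<Sum>i\<in>UNIV. cnj (u $ i) * w $ i)"

lemma cdot_add_left: "cdot (u + v) w = cdot u w + cdot v w"
  and cdot_add_right: "cdot w (u + v) = cdot w u + cdot w v"
  and cdot_scaleR_left: "cdot (r *\<^sub>R u) w = r *\<^sub>R cdot u w"
  and cdot_scaleR_right: "cdot u (r *\<^sub>R w) = r *\<^sub>R cdot u w"
  by (simp_all add: cdot_def algebra_simps sum.distrib scaleR_sum_right)

lemma matrix_vector_mult_scaleR_complex: "A *v (r *\<^sub>R w) = r *\<^sub>R (A *v w)"
  for A :: "complex^'d^'e"
  by (simp add: vec_eq_iff matrix_vector_mult_def scaleR_sum_right)

lemma Re_cdot_self: "Re (cdot u u) = (\<Sum>i\<in>UNIV. (cmod (u $ i))\<^sup>2)"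
  by (simp add: cdot_def complex_norm_square[symmetric] mult.commute)

lemma Re_cdot_self_eq_0_iff: "Re (cdot u u) = 0 \<longleftrightarrow> u = 0"
  by (simp add: Re_cdot_self sum_nonneg_eq_0_iff vec_eq_iff)

lemma adjoint_mat_nth [simp]: "adjoint_mat A $ i $ j = cnj (A $ j $ i)"
  by (simp add: adjoint_mat_def)

lemma cdot_adjoint_mat: "cdot u (A *v w) = cdot (adjoint_mat A *v u) w"
proof -
  have "cdot u (A *v w) = (\<Sum>i\<in>UNIV. \<Sum>j\<in>UNIV. cnj (u $ i) * A $ i $ j * w $ j)"
    by (simp add: cdot_def matrix_vector_mult_def sum_distrib_left mult_ac)
  also have "\<dots> = (\<Sum>j\<in>UNIV. \<Sum>i\<in>UNIV. cnj (u $ i) * A $ i $ j * w $ j)"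
    by (rule sum.swap)
  also have "\<dots> = cdot (adjoint_mat A *v u) w"
    by (simp add: cdot_def matrix_vector_mult_def sum_distrib_left sum_distrib_right mult_ac)
  finally show ?thesis .
qed

lemma adjoint_mat_mult: "adjoint_mat (A ** B) = adjoint_mat B ** adjoint_mat A"
  by (simp add: vec_eq_iff matrix_matrix_mult_def mult.commute)

lemma adjoint_mat_diff: "adjoint_mat (A - B) = adjoint_mat A - adjoint_mat B"
  by (simp add: vec_eq_iff)

lemma psd_mat_cdot:
  "psd_mat A \<longleftrightarrow> adjoint_mat A = A \<and> (\<forall>v. 0 \<le> Re (cdot v (A *v v)))"
  by (simp add: psd_mat_def cdot_def)

lemma psd_mat_congruence:
  assumes "psd_mat A" "adjoint_mat S = S"
  shows "psd_mat (S ** A ** S)"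
proof -
  have "cdot v ((S ** A ** S) *v v) = cdot (S *v v) (A *v (S *v v))" for v
    using cdot_adjoint_mat[of v S "A *v (S *v v)"] assms(2)
    by (simp add: matrix_vector_mul_assoc matrix_mul_assoc)
  then show ?thesis
    using assms by (simp add: psd_mat_cdot adjoint_mat_mult matrix_mul_assoc)
qed

lemma psd_mat_square:
  assumes "adjoint_mat S = S"
  shows "psd_mat (S ** S)"
proof -
  have "Re (cdot v ((S ** S) *v v)) \<ge> 0" for v
    using cdot_adjoint_mat[of v S "S *v v"] assms
    by (simp add: matrix_vector_mul_assoc Re_cdot_self sum_nonneg)
  then show ?thesis
    using assms by (simp add: psd_mat_cdot adjoint_mat_mult)
qed

lemma matrix_vector_mult_axis_nth: "(A *v axis i 1) $ j = A $ j $ i" for A :: "complex^'d^'e"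
  by (simp add: matrix_vector_mult_def axis_def if_distrib[of "\<lambda>x. _ * x"] cong: if_cong)

lemma cdot_axis: "cdot (axis i 1) (A *v axis i 1) = A $ i $ i"
  unfolding cdot_def matrix_vector_mult_axis_nth
  by (simp add: axis_def if_distrib[of "\<lambda>x. x * _"] if_distrib[of cnj] cong: if_cong)

lemma psd_mat_diagonal_nonneg: "psd_mat A \<Longrightarrow> 0 \<le> Re (A $ i $ i)"
  unfolding psd_mat_cdot by (metis cdot_axis)

lemma Re_trace_psd_mat_nonneg: "psd_mat A \<Longrightarrow> 0 \<le> Re (trace A)"
  by (simp add: trace_def psd_mat_diagonal_nonneg sum_nonneg)

text \<open>Cyclicity of the trace turns the product into \<open>S ** A ** S\<close>. For a
  projector S this makes outcome probabilities nonnegative, also for tensor products of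
  projectors.\<close>

lemma Re_trace_psd_mat_square_nonneg:
  assumes "psd_mat A" "adjoint_mat S = S"
  shows "0 \<le> Re (trace (A ** (S ** S)))"
proof -
  have "trace (A ** (S ** S)) = trace (S ** A ** S)"
    using trace_mul_sym[of "A ** S" S] by (simp add: matrix_mul_assoc)
  then show ?thesis
    using Re_trace_psd_mat_nonneg[OF psd_mat_congruence[OF assms]] by simp
qed

text \<open>A null vector minimizes the quadratic form. Moving from v along B v changes the form to
  first order by twice the squared norm of B v, so a small step backwards would make it negative
  unless B v = 0.\<close>

lemma psd_mat_null_vector:
  assumes psd: "psd_mat B" and null: "Re (cdot v (B *v v)) = 0"
  shows "B *v v = 0"
proof (rule ccontr)
  define w where "w = B *v v"
  define N where "N = Re (cdot w w)"
  define K where "K = Re (cdot w (B *v w))"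
  assume "B *v v \<noteq> 0"
  then have N: "N > 0"
    by (metis N_def Re_cdot_self Re_cdot_self_eq_0_iff less_eq_real_def sum_nonneg w_def zero_le_power2)
  have K: "K \<ge> 0" using psd by (simp add: K_def psd_mat_cdot)
  have "cdot v (B *v w) = cdot w w"
    using cdot_adjoint_mat[of v B w] psd by (simp add: psd_mat_cdot w_def)
  then have "Re (cdot (v + s *\<^sub>R w) (B *v (v + s *\<^sub>R w))) = 2 * s * N + s\<^sup>2 * K" for s
    using null
    by (simp add: matrix_vector_right_distrib matrix_vector_mult_scaleR_complex cdot_add_left cdot_add_right
        cdot_scaleR_left cdot_scaleR_right N_def K_def flip: w_def)
      (simp add: w_def power2_eq_square algebra_simps)
  then have "0 \<le> 2 * s * N + s\<^sup>2 * K" for s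
    using psd unfolding psd_mat_cdot by metis
  \<comment> \<open>A step that beats the quadratic term; the 1 added to K keeps the denominator
    positive when K = 0.\<close>
  moreover have "2 * s * N + s\<^sup>2 * K = N\<^sup>2 * (- K - 2) / (K + 1)\<^sup>2" if "s = - (N / (K + 1))" for s
  proof -
    have "s * (K + 1) = - N" using K that by simp
    then have "(2 * s * N + s\<^sup>2 * K) * (K + 1)\<^sup>2 = N\<^sup>2 * (- K - 2)" by algebra
    then show ?thesis using K by (simp add: eq_divide_eq)
  qed
  moreover have "N\<^sup>2 * (- K - 2) / (K + 1)\<^sup>2 < 0"
    using N K by (intro divide_neg_pos mult_pos_neg) auto
  ultimately show False by (metis not_less)
qed

text \<open>
  For \<open>D = B - C\<close>, the trace of \<open>D B D + D C D\<close> vanishes by cyclicity. Both summands are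
  positive semidefinite, so \<open>B D = C D = 0\<close> and \<open>D\<^sup>2 = 0\<close>.
\<close>
lemma psd_mat_sqrt_unique:
  fixes B C :: "complex^'d^'d"
  assumes B: "psd_mat B" and C: "psd_mat C" and eq: "B ** B = C ** C"
  shows "B = C"
proof -
  define D where "D = B - C"
  have hD: "adjoint_mat D = D"
    using B C by (simp add: D_def adjoint_mat_diff psd_mat_def)
  have sub_r: "X ** (Y - Z) = X ** Y - X ** Z" for X Y Z :: "complex^'d^'d"
    by (simp add: vec_eq_iff matrix_matrix_mult_def algebra_simps sum_subtractf)
  have sub_l: "(Y - Z) ** X = Y ** X - Z ** X" for X Y Z :: "complex^'d^'d"
    by (simp add: vec_eq_iff matrix_matrix_mult_def algebra_simps sum_subtractf)
  have cyc: "trace (X ** Y ** Z) = trace (Z ** X ** Y)" for X Y Z :: "complex^'d^'d"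
    using trace_mul_sym[of "X ** Y" Z] by (simp add: matrix_mul_assoc)
  have "trace (D ** B ** D) + trace (D ** C ** D) = 0"
  proof -
    have "trace (D ** B ** D) + trace (D ** C ** D)
        = trace (B ** B ** B) - trace (B ** B ** C) - trace (C ** B ** B) + trace (C ** B ** C)
          + trace (B ** C ** B) - trace (B ** C ** C) - trace (C ** C ** B) + trace (C ** C ** C)"
      by (simp add: D_def sub_r sub_l trace_sub)
    also have "\<dots> = 0"
      using cyc[of B B C] cyc[of B C B] cyc[of C C B] cyc[of C B C] eq
      by (simp add: matrix_mul_assoc)
    finally show ?thesis .
  qed
  \<comment> \<open>A sum of nonnegative diagonal entries vanishes only entrywise, so each column of
    D is a null vector of X.\<close>
  moreover have zero: "X ** D = 0" if "psd_mat X" "Re (trace (D ** X ** D)) = 0" for X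
  proof -
    have "Re ((D ** X ** D) $ i $ i) = 0" for i
      using that psd_mat_diagonal_nonneg[OF psd_mat_congruence[OF that(1) hD]]
      by (simp add: trace_def sum_nonneg_eq_0_iff)
    moreover have "cdot (D *v u) (X *v (D *v u)) = cdot u ((D ** X ** D) *v u)" for u
      using cdot_adjoint_mat[of u D "X *v (D *v u)"] hD
      by (simp add: matrix_vector_mul_assoc matrix_mul_assoc)
    ultimately have "Re (cdot (D *v axis i 1) (X *v (D *v axis i 1))) = 0" for i
      by (simp add: cdot_axis)
    then have "(X ** D) *v axis i 1 = 0" for i
      using psd_mat_null_vector[OF that(1), of "D *v axis i 1"] by (simp add: matrix_vector_mul_assoc)
    then show ?thesis
      by (simp add: matrix_vector_mult_axis_nth vec_eq_iff)
  qed
  moreover have "Re (trace (D ** B ** D)) \<ge> 0" "Re (trace (D ** C ** D)) \<ge> 0"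
    using Re_trace_psd_mat_nonneg[OF psd_mat_congruence] B C hD by auto
  ultimately have "B ** D = 0" "C ** D = 0"
    using B C by (auto simp: complex_eq_iff intro!: zero)
  then have "D ** D = 0"
    by (simp add: D_def sub_l)
  have "D *v u = 0" for u
  proof -
    have "cdot (D *v u) (D *v u) = cdot u ((D ** D) *v u)"
      using cdot_adjoint_mat[of u D "D *v u"] hD by (simp add: matrix_vector_mul_assoc)
    then have "Re (cdot (D *v u) (D *v u)) = 0"
      using \<open>D ** D = 0\<close> by (simp add: cdot_def matrix_vector_mult_def)
    then show ?thesis by (simp add: Re_cdot_self_eq_0_iff)
  qed
  then have "D *v u = 0 *v u" for u
    by (simp add: matrix_vector_mult_def vec_eq_iff)
  then have "D = 0" unfolding matrix_eq by blast
  then show ?thesis by (simp add: D_def)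
qed

lemma sqrt_mat_square: "psd_mat B \<Longrightarrow> sqrt_mat (B ** B) = B"
  unfolding sqrt_mat_def by (rule the_equality) (auto intro: psd_mat_sqrt_unique)

section \<open>Tensor products\<close>

lemma prod_sum_UNIV:
  fixes h :: "'n::finite \<Rightarrow> 'i::finite \<Rightarrow> 'c::comm_semiring_1"
  shows "(\<Prod>j\<in>UNIV. \<Sum>i\<in>UNIV. h j i) = (\<Sum>x\<in>UNIV. \<Prod>j\<in>UNIV. h j (x j))"
  using prod_sum_PiE[of "UNIV :: 'n set" "\<lambda>_. UNIV :: 'i set" h] by simp

lemma tensor_nth: "tensor A $ x $ y = (\<Prod>j\<in>UNIV. A j $ x j $ y j)"
  by (simp add: tensor_def)

lemma tensor_mult: "tensor A ** tensor B = tensor (\<lambda>j. A j ** B j)"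
  by (simp add: vec_eq_iff matrix_matrix_mult_def tensor_nth prod_sum_UNIV flip: prod.distrib)

lemma trace_tensor: "trace (tensor A) = (\<Prod>j\<in>UNIV. trace (A j))"
  by (simp add: trace_def tensor_nth prod_sum_UNIV)

lemma adjoint_mat_tensor: "adjoint_mat (tensor A) = tensor (\<lambda>j. adjoint_mat (A j))"
  by (simp add: vec_eq_iff tensor_nth)

lemma tensor_mat_1: "tensor (\<lambda>j. mat 1) = mat 1"
proof -
  have "(\<Prod>j\<in>UNIV. if x j = y j then 1 else 0 :: complex) = (if x = y then 1 else 0)"
    for x y :: "'n::finite \<Rightarrow> 2"
    by (auto simp: fun_eq_iff)
  then show ?thesis
    by (simp add: vec_eq_iff tensor_nth mat_def fun_eq_iff)
qed

lemma tensor_sum: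
  fixes B :: "'n::finite \<Rightarrow> 'i \<Rightarrow> complex^2^2"
  assumes "finite I"
  shows "tensor (\<lambda>j. \<Sum>i\<in>I. B j i) = (\<Sum>x\<in>Pi\<^sub>E UNIV (\<lambda>_. I). tensor (\<lambda>j. B j (x j)))"
  using assms by (simp add: vec_eq_iff tensor_nth prod_sum_PiE)

text \<open>Multiplication by a complex scalar c is written \<open>mat c ** A\<close> throughout, as
  \<open>scaleR\<close> covers real scalars only.\<close>

lemma mat_mult_nth [simp]: "(mat c ** A) $ i $ j = c * A $ i $ j"
  by (simp add: matrix_matrix_mult_def mat_def if_distrib if_distribR cong: if_cong)

lemma tensor_scale: "tensor (\<lambda>j. mat (c j) ** A j) = mat (\<Prod>j\<in>UNIV. c j) ** tensor A"
  by (simp add: vec_eq_iff tensor_nth prod.distrib)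

lemma trace_mult_scale: "trace (D ** (mat c ** A)) = c * trace (D ** A)"
  for A D :: "complex^'d^'d"
  by (simp add: trace_def matrix_matrix_mult_def[of D] sum_distrib_left mult_ac)

lemma trace_mult_sum: "trace (D ** (\<Sum>x\<in>I. A x)) = (\<Sum>x\<in>I. trace (D ** A x))"
  for A :: "_ \<Rightarrow> complex^'d^'d"
proof (induction I rule: infinite_finite_induct)
  case (insert x I)
  then show ?case by (simp add: matrix_add_ldistrib trace_add)
qed (simp_all add: trace_def matrix_matrix_mult_def)

lemma trace_tensor_sum:
  fixes B :: "'n::finite \<Rightarrow> 'i \<Rightarrow> complex^2^2" and c :: "'n \<Rightarrow> 'i \<Rightarrow> complex"
  assumes "finite I"
  shows "trace (D ** tensor (\<lambda>j. \<Sum>i\<in>I. mat (c j i) ** B j i))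
      = (\<Sum>x\<in>Pi\<^sub>E UNIV (\<lambda>_. I). (\<Prod>j\<in>UNIV. c j (x j)) * trace (D ** tensor (\<lambda>j. B j (x j))))"
  using assms by (simp add: tensor_sum trace_mult_sum tensor_scale trace_mult_scale)

lemma outcomes_PiE: "outcomes = Pi\<^sub>E UNIV (\<lambda>_. {1, - 1})"
  by (auto simp: outcomes_def PiE_def Pi_def)

text \<open>Multilinearity, applied first to the settings and then to the outcomes. It serves both
  the optimality bound, with likelihood ratios as coefficients, and uniqueness, with the
  coefficients of matrix units.\<close>

lemma trace_tensor_sum_outcomes:
  fixes B :: "'n::finite \<Rightarrow> 3 \<Rightarrow> real \<Rightarrow> complex^2^2" and c :: "'n \<Rightarrow> 3 \<Rightarrow> real \<Rightarrow> complex"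
  shows "trace (D ** tensor (\<lambda>j. \<Sum>k\<in>UNIV. \<Sum>a\<in>{1, - 1}. mat (c j k a) ** B j k a))
      = (\<Sum>k\<in>UNIV. \<Sum>a\<in>outcomes.
          (\<Prod>j\<in>UNIV. c j (k j) (a j)) * trace (D ** tensor (\<lambda>j. B j (k j) (a j))))"
proof -
  have "trace (D ** tensor (\<lambda>j. \<Sum>a\<in>{1, - 1}. mat (c j (k j) a) ** B j (k j) a))
      = (\<Sum>a\<in>outcomes. (\<Prod>j\<in>UNIV. c j (k j) (a j)) * trace (D ** tensor (\<lambda>j. B j (k j) (a j))))"
    for k :: "'n \<Rightarrow> 3"
    by (simp add: trace_tensor_sum outcomes_PiE del: sum.insert)
  then show ?thesis
    by (subst tensor_sum) (simp_all add: trace_mult_sum del: sum.insert)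
qed

text \<open>A tensor product of matrix units is a matrix unit, so testing against such products
  recovers every entry of D.\<close>

lemma trace_tensor_mult_axis:
  fixes x y :: "'n::finite \<Rightarrow> 2"
  shows "trace (D ** tensor (\<lambda>j. (\<chi> a b. if a = x j \<and> b = y j then 1 else 0))) = D $ y $ x"
proof -
  have "(\<Prod>j\<in>UNIV. if z j = x j \<and> w j = y j then 1 else 0 :: complex)
      = (if z = x \<and> w = y then 1 else 0)" for z w
    by (auto simp: fun_eq_iff)
  moreover have "(\<Sum>k\<in>UNIV. if k = x \<and> i = y then D $ i $ k else 0) = (if i = y then D $ i $ x else 0)" for i
    by (cases "i = y") auto
  ultimately show ?thesis
    by (simp add: trace_def matrix_matrix_mult_def tensor_nth if_distrib[of "\<lambda>x. _ * x"] cong: if_cong)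
qed

section \<open>Single qubits\<close>

definition pauli_mat :: "real \<Rightarrow> real^3 \<Rightarrow> complex^2^2" where
  "pauli_mat x v = x *\<^sub>R mat 1 + dot_sigma v"

lemma pauli_mat_nth:
  "pauli_mat x v $ 1 $ 1 = Complex (x + v $ 3) 0"
  "pauli_mat x v $ 1 $ 2 = Complex (v $ 1) (- v $ 2)"
  "pauli_mat x v $ 2 $ 1 = Complex (v $ 1) (v $ 2)"
  "pauli_mat x v $ 2 $ 2 = Complex (x - v $ 3) 0"
  by (simp_all add: pauli_mat_def dot_sigma_def pauli_def sum_3 sigma_x_def sigma_y_def sigma_z_def
      mat_def complex_eq_iff)

lemma inner_vec3: "v \<bullet> w = v $ 1 * w $ 1 + v $ 2 * w $ 2 + v $ 3 * w $ 3" for v w :: "real^3"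
  by (simp add: inner_vec_def sum_3)

lemma norm_vec3: "(norm v)\<^sup>2 = (v $ 1)\<^sup>2 + (v $ 2)\<^sup>2 + (v $ 3)\<^sup>2" for v :: "real^3"
  unfolding power2_norm_eq_inner inner_vec3 by (simp add: power2_eq_square)

lemma hermitian_imp_pauli_mat:
  assumes "adjoint_mat A = A"
  obtains x v where "A = pauli_mat x v"
proof
  let ?x = "Re (A $ 1 $ 1 + A $ 2 $ 2) / 2"
  let ?v = "vector [Re (A $ 1 $ 2), - Im (A $ 1 $ 2), Re (A $ 1 $ 1 - A $ 2 $ 2) / 2]"
  have "cnj (A $ j $ i) = A $ i $ j" for i j
    using assms by (metis adjoint_mat_nth)
  from this[of 1 1] this[of 2 2] this[of 1 2] this[of 2 1] show "A = pauli_mat ?x ?v"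
    by (simp add: vec_eq_iff forall_2 pauli_mat_nth complex_eq_iff field_simps)
qed

lemma adjoint_pauli_mat [simp]: "adjoint_mat (pauli_mat x v) = pauli_mat x v"
  by (simp add: vec_eq_iff forall_2 pauli_mat_nth complex_eq_iff)

lemma trace_pauli_mat: "trace (pauli_mat x v) = of_real (2 * x)"
  by (simp add: trace_def sum_2 pauli_mat_nth complex_eq_iff)

lemma trace_pauli_mat_mult: "Re (trace (pauli_mat x v ** pauli_mat y w)) = 2 * (x * y + v \<bullet> w)"
  and Im_trace_pauli_mat_mult: "Im (trace (pauli_mat x v ** pauli_mat y w)) = 0"
  by (simp_all add: trace_def matrix_matrix_mult_def sum_2 pauli_mat_nth inner_vec3 algebra_simps)

lemma det_pauli_mat: "det (pauli_mat x v) = of_real (x\<^sup>2 - (norm v)\<^sup>2)"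
  unfolding norm_vec3 by (simp add: det_2 pauli_mat_nth complex_eq_iff power2_eq_square algebra_simps)

text \<open>Distinct Pauli matrices anticommute, so the square of \<open>dot_sigma v\<close> is a
  multiple of the identity and only the cross term keeps a Pauli part.\<close>

lemma pauli_mat_square: "pauli_mat x v ** pauli_mat x v = pauli_mat (x\<^sup>2 + (norm v)\<^sup>2) ((2 * x) *\<^sub>R v)"
  unfolding norm_vec3
  by (simp add: vec_eq_iff forall_2 matrix_matrix_mult_def sum_2 pauli_mat_nth complex_eq_iff
      power2_eq_square algebra_simps)

lemma pauli_mat_1_0: "pauli_mat 1 0 = mat 1"
  by (simp add: pauli_mat_def dot_sigma_def)

lemma pauli_mat_scale: "mat (of_real c) ** pauli_mat x v = pauli_mat (c * x) (c *\<^sub>R v)"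
  by (simp add: vec_eq_iff forall_2 pauli_mat_nth complex_eq_iff algebra_simps)

lemma pauli_mat_add: "pauli_mat x v + pauli_mat y w = pauli_mat (x + y) (v + w)"
  by (simp add: vec_eq_iff forall_2 pauli_mat_nth complex_eq_iff)

lemma bloch_state_pauli_mat: "bloch_state t = pauli_mat (1 / 2) ((1 / 2) *\<^sub>R t)"
  by (simp add: bloch_state_def pauli_mat_def dot_sigma_def scaleR_right_distrib scaleR_sum_right)

lemma dot_sigma_axis: "dot_sigma (axis k 1) = pauli k"
  by (simp add: dot_sigma_def axis_def if_distrib[of "\<lambda>x. x *\<^sub>R _"] cong: if_cong)

lemma outcome_proj_pauli_mat: "outcome_proj a (dot_sigma n) = pauli_mat (1 / 2) ((a / 2) *\<^sub>R n)"
  by (simp add: outcome_proj_def pauli_mat_def dot_sigma_def scaleR_right_distrib scaleR_sum_right)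

text \<open>
  The square root has the same eigenvectors; its eigenvalues are the square roots of
  \<open>x + norm v\<close> and \<open>x - norm v\<close>.
\<close>
lemma pauli_mat_sqrt:
  assumes "norm v \<le> x"
  obtains y w where "norm w \<le> y" "pauli_mat y w ** pauli_mat y w = pauli_mat x v"
    "(2 * y)\<^sup>2 = 2 * x + 2 * sqrt (x\<^sup>2 - (norm v)\<^sup>2)"
proof -
  define p where "p = sqrt (x + norm v)"
  define q where "q = sqrt (x - norm v)"
  have nn: "x + norm v \<ge> 0" using assms norm_ge_zero[of v] by linarith
  then have pq: "p\<^sup>2 = x + norm v" "q\<^sup>2 = x - norm v" "p \<ge> q" "q \<ge> 0"
    using assms by (simp_all add: p_def q_def)
  define w where "w = ((p - q) / 2) *\<^sub>R sgn v"
  have nw: "norm w \<le> (p - q) / 2" "(norm w)\<^sup>2 = ((p - q) / 2)\<^sup>2"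
  proof -
    \<comment> \<open>\<open>sgn v\<close> is a unit vector except at v = 0, where it is 0; there
      the two roots agree, so the norm formula survives.\<close>
    have "(p - q) / 2 = 0" if "v = 0" using that by (simp add: p_def q_def)
    then show "norm w \<le> (p - q) / 2" "(norm w)\<^sup>2 = ((p - q) / 2)\<^sup>2"
      using pq by (auto simp: w_def norm_sgn)
  qed
  have "(2 * ((p + q) / 2)) *\<^sub>R w = ((p\<^sup>2 - q\<^sup>2) / 2) *\<^sub>R sgn v"
    by (simp add: w_def field_simps power2_eq_square)
  also have "\<dots> = v"
    by (cases "v = 0") (simp_all add: pq sgn_div_norm)
  finally have 1: "(2 * ((p + q) / 2)) *\<^sub>R w = v" .
  have 2: "((p + q) / 2)\<^sup>2 + (norm w)\<^sup>2 = x"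
    using pq(1,2) nw(2) by (simp add: power2_eq_square field_simps)
  have "p * q = sqrt (x\<^sup>2 - (norm v)\<^sup>2)"
    by (simp add: p_def q_def power2_eq_square algebra_simps flip: real_sqrt_mult)
  then have 3: "(2 * ((p + q) / 2))\<^sup>2 = 2 * x + 2 * sqrt (x\<^sup>2 - (norm v)\<^sup>2)"
    using pq(1,2) by (simp add: power2_eq_square algebra_simps)
  show ?thesis
    by (rule that[of w "(p + q) / 2"]) (use nw pq 1 2 3 in \<open>auto simp: pauli_mat_square\<close>)
qed

lemma psd_pauli_mat:
  assumes "norm v \<le> x"
  shows "psd_mat (pauli_mat x v)"
proof -
  from pauli_mat_sqrt[OF assms] obtain y w where "pauli_mat y w ** pauli_mat y w = pauli_mat x v"
    by metis
  then show ?thesis using psd_mat_square[of "pauli_mat y w"] by simp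
qed

text \<open>For a unit vector h, the eigenprojector of \<open>dot_sigma h\<close> for the eigenvalue
  1.\<close>

definition spin_proj :: "real^3 \<Rightarrow> complex^2^2" where
  "spin_proj h = pauli_mat (1 / 2) ((1 / 2) *\<^sub>R h)"

lemma spin_proj_idem:
  assumes "norm h = 1"
  shows "spin_proj h ** spin_proj h = spin_proj h"
  using assms by (simp add: spin_proj_def pauli_mat_square power2_eq_square)

text \<open>Necessity comes from testing against the projector for the direction h opposite to v,
  which exposes the smallest eigenvalue \<open>x - norm v\<close>.\<close>

lemma psd_pauli_mat_iff: "psd_mat (pauli_mat x v) \<longleftrightarrow> norm v \<le> x"
proof
  assume psd: "psd_mat (pauli_mat x v)"
  obtain h :: "real^3" where h: "norm h = 1" "v \<bullet> h = - norm v"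
  proof (cases "v = 0")
    case True
    then show ?thesis using that[of "axis 1 1"] by simp
  next
    case False
    then show ?thesis
      using that[of "- sgn v"] by (simp add: norm_sgn sgn_div_norm power2_norm_eq_inner[symmetric] power2_eq_square)
  qed
  have "0 \<le> Re (trace (pauli_mat x v ** (spin_proj h ** spin_proj h)))"
    using psd by (rule Re_trace_psd_mat_square_nonneg) (simp add: spin_proj_def)
  then show "norm v \<le> x"
    using h unfolding spin_proj_idem[OF h(1)] by (simp add: spin_proj_def trace_pauli_mat_mult)
qed (rule psd_pauli_mat)

lemma density_bloch_state_iff: "density_mat (bloch_state t) \<longleftrightarrow> norm t \<le> 1"
  by (simp add: density_mat_def bloch_state_pauli_mat psd_pauli_mat_iff trace_pauli_mat)

lemma density_mat_imp_bloch_state: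
  assumes "density_mat \<tau>"
  obtains t where "\<tau> = bloch_state t" "norm t \<le> 1"
proof -
  obtain x v where xv: "\<tau> = pauli_mat x v"
    using assms hermitian_imp_pauli_mat by (auto simp: density_mat_def psd_mat_def)
  then have "x = 1 / 2"
    using assms by (simp add: density_mat_def trace_pauli_mat complex_eq_iff)
  then have eq: "\<tau> = bloch_state (2 *\<^sub>R v)"
    using xv \<open>x = 1 / 2\<close> by (simp add: bloch_state_pauli_mat del: eq_divide_eq_numeral1)
  then show ?thesis using that assms density_bloch_state_iff by auto
qed

text \<open>For eigenvalues p and q, the square of sqrt p + sqrt q is p + q + 2 sqrt (p q), that is,
  the trace plus twice the root of the determinant.\<close>

lemma psd_mat_2_sqrt:
  fixes A :: "complex^2^2"
  assumes "psd_mat A"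
  obtains B where "psd_mat B" "B ** B = A" "(Re (trace B))\<^sup>2 = Re (trace A) + 2 * sqrt (Re (det A))"
proof -
  obtain x v where A: "A = pauli_mat x v"
    using assms hermitian_imp_pauli_mat by (auto simp: psd_mat_def)
  then have "norm v \<le> x" using assms psd_pauli_mat_iff by simp
  from pauli_mat_sqrt[OF this] obtain y w where yw: "norm w \<le> y"
    "pauli_mat y w ** pauli_mat y w = pauli_mat x v" "(2 * y)\<^sup>2 = 2 * x + 2 * sqrt (x\<^sup>2 - (norm v)\<^sup>2)"
    by metis
  have d: "Re (det A) = x\<^sup>2 - (norm v)\<^sup>2"
    unfolding A det_pauli_mat by (rule Re_complex_of_real)
  have t: "Re (trace A) = 2 * x" "Re (trace (pauli_mat y w)) = 2 * y"
    unfolding A trace_pauli_mat by (simp_all only: Re_complex_of_real)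
  show ?thesis
    by (rule that[of "pauli_mat y w"]) (simp_all add: psd_pauli_mat yw(1) yw(2) A[symmetric] d t yw(3)[simplified])
qed

section \<open>Positivity, square roots and fidelity of tensor products\<close>

lemma psd_mat_tensor:
  assumes "\<And>j. psd_mat (A j)"
  shows "psd_mat (tensor A)"
proof -
  have "\<forall>j. \<exists>B. psd_mat B \<and> B ** B = A j"
    using psd_mat_2_sqrt[OF assms] by metis
  then obtain B where B: "\<And>j. psd_mat (B j)" "\<And>j. B j ** B j = A j"
    by metis
  then have "psd_mat (tensor B ** tensor B)"
    by (intro psd_mat_square) (simp add: adjoint_mat_tensor psd_mat_def)
  then show ?thesis by (simp add: tensor_mult B)
qed

lemma density_mat_tensor:
  assumes "\<And>j. density_mat (A j)"
  shows "density_mat (tensor A)"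
  using assms psd_mat_tensor[of A] by (simp add: density_mat_def trace_tensor)

lemma sqrt_mat_tensor:
  assumes "\<And>j. psd_mat (A j)"
  shows "psd_mat (sqrt_mat (A j))" "sqrt_mat (A j) ** sqrt_mat (A j) = A j"
    "sqrt_mat (tensor A) = tensor (\<lambda>j. sqrt_mat (A j))"
proof -
  have *: "psd_mat (sqrt_mat (A j)) \<and> sqrt_mat (A j) ** sqrt_mat (A j) = A j" for j
    using psd_mat_2_sqrt[OF assms] sqrt_mat_square by metis
  then show "psd_mat (sqrt_mat (A j))" "sqrt_mat (A j) ** sqrt_mat (A j) = A j"
    by auto
  have "psd_mat (tensor (\<lambda>j. sqrt_mat (A j)))"
    using * by (intro psd_mat_tensor) auto
  from sqrt_mat_square[OF this] show "sqrt_mat (tensor A) = tensor (\<lambda>j. sqrt_mat (A j))"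
    using * by (simp add: tensor_mult)
qed

lemma trace_sqrt_mat_2:
  fixes A :: "complex^2^2"
  assumes "psd_mat A"
  shows "(Re (trace (sqrt_mat A)))\<^sup>2 = Re (trace A) + 2 * sqrt (Re (det A))"
  using psd_mat_2_sqrt[OF assms] sqrt_mat_square by metis

lemma fidelity_tensor:
  assumes \<tau>: "\<And>j. psd_mat (\<tau> j)" and \<rho>: "\<And>j. psd_mat (\<rho> j)"
  shows "fidelity (tensor \<tau>) (tensor \<rho>) = (\<Prod>j\<in>UNIV. fidelity (\<tau> j) (\<rho> j))"
proof -
  define X where "X j = sqrt_mat (\<tau> j) ** \<rho> j ** sqrt_mat (\<tau> j)" for j
  have X: "psd_mat (X j)" for j
  proof -
    have "adjoint_mat (sqrt_mat (\<tau> j)) = sqrt_mat (\<tau> j)"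
      using sqrt_mat_tensor(1)[of \<tau>, OF \<tau>] unfolding psd_mat_def by blast
    from psd_mat_congruence[OF \<rho> this] show ?thesis by (simp only: X_def)
  qed
  have "fidelity (tensor \<tau>) (tensor \<rho>) = (Re (\<Prod>j\<in>UNIV. trace (sqrt_mat (X j))))\<^sup>2"
    unfolding fidelity_def sqrt_mat_tensor(3)[of \<tau>, OF \<tau>] tensor_mult
    using sqrt_mat_tensor(3)[of X, OF X] by (simp add: trace_tensor flip: X_def)
  \<comment> \<open>The real part does not commute with products in general, so each trace is first
    shown to be real.\<close>
  also have "(\<Prod>j\<in>UNIV. trace (sqrt_mat (X j))) = (\<Prod>j\<in>UNIV. of_real (Re (trace (sqrt_mat (X j)))))"
  proof (rule prod.cong)
    fix j
    obtain x v where "sqrt_mat (X j) = pauli_mat x v"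
      using sqrt_mat_tensor(1)[of X, OF X, of j] by (meson hermitian_imp_pauli_mat psd_mat_def)
    then show "trace (sqrt_mat (X j)) = of_real (Re (trace (sqrt_mat (X j))))"
      by (simp add: trace_pauli_mat)
  qed simp
  also have "(Re \<dots>)\<^sup>2 = (\<Prod>j\<in>UNIV. (Re (trace (sqrt_mat (X j))))\<^sup>2)"
    by (simp add: prod_power_distrib flip: of_real_prod)
  finally show ?thesis by (simp add: fidelity_def X_def)
qed

text \<open>By the trace and determinant formula for the square root: cyclicity reduces the trace to
  that of the product of the two states, and the determinant is multiplicative.\<close>

lemma fidelity_bloch_state:
  assumes "norm t \<le> 1" "norm r \<le> 1"
  shows "fidelity (bloch_state t) (bloch_state r)
    = (1 + t \<bullet> r + sqrt ((1 - (norm t)\<^sup>2) * (1 - (norm r)\<^sup>2))) / 2"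
proof -
  define S where "S = sqrt_mat (bloch_state t)"
  define X where "X = S ** bloch_state r ** S"
  have psd: "psd_mat (bloch_state t)" "psd_mat (bloch_state r)"
    using assms density_bloch_state_iff by (auto simp: density_mat_def)
  note S = sqrt_mat_tensor(1,2)[of "\<lambda>_. bloch_state t", OF psd(1), folded S_def]
  have "trace X = trace (S ** S ** bloch_state r)"
    unfolding X_def using trace_mul_sym[of "S ** bloch_state r" S] by (simp add: matrix_mul_assoc)
  then have tr: "Re (trace X) = (1 + t \<bullet> r) / 2"
    by (simp add: S bloch_state_pauli_mat trace_pauli_mat_mult field_simps)
  have "det X = det (S ** S) * det (bloch_state r)"
    by (simp add: X_def det_mul)
  also have "\<dots> = of_real ((1 - (norm t)\<^sup>2) / 4 * ((1 - (norm r)\<^sup>2) / 4))"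
    unfolding S(2) by (simp add: bloch_state_pauli_mat det_pauli_mat field_simps)
  finally have det: "Re (det X) = (1 - (norm t)\<^sup>2) / 4 * ((1 - (norm r)\<^sup>2) / 4)"
    by (simp only: Re_complex_of_real)
  have "psd_mat X"
    using psd_mat_congruence[OF psd(2)] S by (simp add: X_def psd_mat_def)
  from trace_sqrt_mat_2[OF this]
  have "fidelity (bloch_state t) (bloch_state r)
      = (1 + t \<bullet> r) / 2 + 2 * sqrt ((1 - (norm t)\<^sup>2) * (1 - (norm r)\<^sup>2) / 4\<^sup>2)"
    by (simp add: fidelity_def tr det flip: S_def X_def)
  then show ?thesis
    by (simp only: real_sqrt_divide) (simp add: field_simps)
qed

section \<open>Maximum likelihood for one qubit\<close>

text \<open>
  \<open>r\<close> is the Bloch vector reconstructed from the measured expectation values \<open>f\<close>. The last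
  condition says that the operator \<open>\<Sum>\<^sub>k \<Sum>\<^sub>a P(a|k) / tr (\<rho> \<Pi>) \<cdot> \<Pi>\<close>, with \<open>\<Pi>\<close> the projector
  onto the outcome \<open>a\<close> of \<open>M\<^sub>k\<close>, is at most \<open>3\<close>; outcomes of probability \<open>0\<close> contribute \<open>0\<close>,
  also where the denominator vanishes.
\<close>
definition qubit_ml :: "real^3 \<Rightarrow> real^3 \<Rightarrow> bool" where
  "qubit_ml f r \<longleftrightarrow> norm r \<le> 1 \<and>
    (\<forall>k. \<forall>a\<in>{1, - 1}. 0 < 1 + a * f $ k \<longrightarrow> 0 < 1 + a * r $ k) \<and>
    (\<forall>r'. norm r' \<le> 1 \<longrightarrow>
      (\<Sum>k\<in>UNIV. \<Sum>a\<in>{1, - 1}. (1 + a * f $ k) / 2 * ((1 + a * r' $ k) / (1 + a * r $ k))) \<le> 3)"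

lemma abs_component_le_1: "norm r \<le> 1 \<Longrightarrow> \<bar>r $ k\<bar> \<le> 1" for r :: "real^3"
  using component_le_norm_cart[of r k] by linarith

lemma signed_component_nonneg:
  fixes r :: "real^3"
  assumes "norm r \<le> 1" "a \<in> {1, - 1}"
  shows "0 \<le> 1 + a * r $ k"
  using abs_component_le_1[OF assms(1), of k] assms(2) by auto

text \<open>With r = f the denominators cancel the data, and each setting contributes the total
  probability 1 predicted by r'. If an outcome is certain, only its predicted probability remains,
  which is at most 1.\<close>

lemma qubit_ml_self:
  assumes f: "norm f \<le> 1"
  shows "qubit_ml f f"
proof -
  have "(\<Sum>a\<in>{1, - 1}. (1 + a * f $ k) / 2 * ((1 + a * r $ k) / (1 + a * f $ k))) \<le> 1"
    if r: "norm r \<le> 1" for r k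
    using abs_component_le_1[OF f, of k] abs_component_le_1[OF r, of k]
    by (cases "f $ k = 1"; cases "f $ k = - 1") (auto simp: field_simps)
  then have "(\<Sum>k\<in>UNIV. \<Sum>a\<in>{1, - 1}. (1 + a * f $ k) / 2 * ((1 + a * r $ k) / (1 + a * f $ k)))
      \<le> (\<Sum>k\<in>(UNIV :: 3 set). 1)" if "norm r \<le> 1" for r
    using that by (intro sum_mono) auto
  then show ?thesis
    using f by (simp add: qubit_ml_def del: sum.insert)
qed

text \<open>\<open>powr\<close> has \<open>0 powr 0 = 0\<close>, but a likelihood factor with exponent \<open>0\<close> must be \<open>1\<close>.\<close>
definition weight_powr :: "real \<Rightarrow> real \<Rightarrow> real" where
  "weight_powr p x = (if p = 0 then 1 else x powr p)"

text \<open>A maximizer of the likelihood over the compact unit ball works: the slope of the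
  log-likelihood towards any r' in the ball is at most 0, and this is the inequality demanded by
  \<open>qubit_ml\<close>.\<close>

lemma qubit_ml_exists:
  assumes f: "\<And>k. \<bar>f $ k\<bar> \<le> 1"
  shows "\<exists>r. qubit_ml f r"
proof -
  define p where "p k a = (1 + a * f $ k) / 2" for k and a :: real
  \<comment> \<open>The likelihood up to a constant factor. Unlike its logarithm, it is continuous
    up to the boundary of the ball.\<close>
  define L where "L r = (\<Prod>k\<in>UNIV. \<Prod>a\<in>{1, - 1}. weight_powr (p k a) (1 + a * r $ k))" for r :: "real^3"
  have p: "0 \<le> p k a" if "a \<in> {1, - 1}" for k a
    using f[of k] that by (auto simp: p_def)
  have psum: "p k 1 + p k (- 1) = 1" for k
    by (simp add: p_def field_simps)
  have "continuous_on (cball 0 1) (\<lambda>r. weight_powr (p k a) (1 + a * r $ k))" if "a \<in> {1, - 1}" for k a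
  proof (cases "p k a = 0")
    case False
    then have "0 < p k a" using p[OF that, of k] by simp
    then have "continuous_on (cball 0 1) (\<lambda>r. (1 + a * r $ k) powr p k a)"
      using signed_component_nonneg[OF _ that]
      by (intro continuous_on_powr' continuous_intros) auto
    then show ?thesis using False by (simp add: weight_powr_def)
  qed (simp add: weight_powr_def)
  then have "continuous_on (cball 0 1) L"
    unfolding L_def by (intro continuous_on_prod)
  from continuous_attains_sup[OF _ _ this] obtain r
    where r: "norm r \<le> 1" and max: "\<And>r'. norm r' \<le> 1 \<Longrightarrow> L r' \<le> L r"
    by auto
  have "weight_powr x 1 = 1" for x by (simp add: weight_powr_def)
  \<comment> \<open>Comparison with the centre of the ball shows that no factor vanishes at the
    maximizer.\<close>
  then have "L 0 = 1" by (simp add: L_def)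
  then have L: "L r > 0" using max[of 0] by simp
  have pos: "0 < 1 + a * r $ k" if "a \<in> {1, - 1}" "p k a \<noteq> 0" for k a
  proof -
    have "weight_powr (p k a) (1 + a * r $ k) \<noteq> 0"
      using L that(1) unfolding L_def by (auto simp: prod_zero_iff less_le)
    then show ?thesis
      using that(2) signed_component_nonneg[OF r that(1), of k] by (auto simp: weight_powr_def less_le)
  qed
  show ?thesis
  proof (intro exI[of _ r], unfold qubit_ml_def, intro conjI allI ballI impI)
    fix k and a :: real assume a: "a \<in> {1, - 1}" "0 < 1 + a * f $ k"
    then have "p k a \<noteq> 0" by (simp add: p_def)
    with a show "0 < 1 + a * r $ k" by (intro pos)
  next
    fix r' :: "real^3" assume r': "norm r' \<le> 1"
    \<comment> \<open>The log-likelihood along the segment from r to r'. For s < 1 every outcome of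
      nonzero weight keeps a positive argument, because it has one at r.\<close>
    define \<phi> where "\<phi> s = (\<Sum>k\<in>UNIV. \<Sum>a\<in>{1, - 1}. p k a * ln (1 + a * (r $ k + s * (r' $ k - r $ k))))" for s
    have Lexp: "L (r + s *\<^sub>R (r' - r)) = exp (\<phi> s)" if s: "0 \<le> s" "s < 1" for s
    proof -
      have "weight_powr (p k a) (1 + a * (r $ k + s * (r' $ k - r $ k)))
          = exp (p k a * ln (1 + a * (r $ k + s * (r' $ k - r $ k))))"
        if a: "a \<in> {1, - 1}" for k a
      proof (cases "p k a = 0")
        case False
        have "1 + a * (r $ k + s * (r' $ k - r $ k)) = (1 - s) * (1 + a * r $ k) + s * (1 + a * r' $ k)"
          by (simp add: algebra_simps)
        also have "\<dots> > 0"
          using s pos[OF a False] signed_component_nonneg[OF r' a, of k]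
          by (intro add_pos_nonneg[OF mult_pos_pos mult_nonneg_nonneg]) auto
        finally show ?thesis using False by (simp add: weight_powr_def powr_def)
      qed (simp add: weight_powr_def)
      then show ?thesis
        unfolding L_def \<phi>_def exp_sum[OF finite] by (simp add: exp_add)
    qed
    have ball: "norm (r + s *\<^sub>R (r' - r)) \<le> 1" if "0 \<le> s" "s \<le> 1" for s
    proof -
      have "(1 - s) *\<^sub>R r + s *\<^sub>R r' \<in> cball 0 1"
        using that r r' by (intro convexD convex_cball) auto
      then show ?thesis by (simp add: algebra_simps)
    qed
    define d where "d = (\<Sum>k\<in>UNIV. \<Sum>a\<in>{1, - 1}. p k a * (a * (r' $ k - r $ k) / (1 + a * r $ k)))"
    have "((\<lambda>s. p k a * ln (1 + a * (r $ k + s * (r' $ k - r $ k)))) has_real_derivative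
        p k a * (a * (r' $ k - r $ k) / (1 + a * r $ k))) (at 0)" if a: "a \<in> {1, - 1}" for k a
    proof (cases "p k a = 0")
      case False
      show ?thesis using pos[OF a False]
        by (auto intro!: derivative_eq_intros simp: divide_simps)
    qed simp
    then have der: "(\<phi> has_real_derivative d) (at 0)"
      unfolding \<phi>_def d_def by (intro DERIV_sum)
    have "d \<le> 0"
    proof (rule ccontr)
      assume "\<not> d \<le> 0"
      then obtain e where e: "e > 0" "\<And>h. 0 < h \<Longrightarrow> h < e \<Longrightarrow> \<phi> 0 < \<phi> (0 + h)"
        using DERIV_pos_inc_right[OF der] by auto
      define h where "h = min (e / 2) (1 / 2)"
      have h: "0 < h" "h < e" "h < 1" using e(1) by (auto simp: h_def)
      have "\<phi> h \<le> \<phi> 0"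
        using max[OF ball, of h] Lexp[of h] Lexp[of 0] h by simp
      then show False using e(2)[of h] h by simp
    qed
    moreover have "p k a * ((1 + a * r' $ k) / (1 + a * r $ k))
        = p k a + p k a * (a * (r' $ k - r $ k) / (1 + a * r $ k))" if a: "a \<in> {1, - 1}" for k a
    proof (cases "p k a = 0")
      case False
      show ?thesis using pos[OF a False] by (simp add: field_simps)
    qed simp
    \<comment> \<open>The 3 counts the settings: the two weights of each sum to 1.\<close>
    then have "(\<Sum>k\<in>UNIV. \<Sum>a\<in>{1, - 1}. p k a * ((1 + a * r' $ k) / (1 + a * r $ k))) = 3 + d"
      by (simp add: d_def sum.distrib psum add.assoc)
    ultimately show "(\<Sum>k\<in>UNIV. \<Sum>a\<in>{1, - 1}. (1 + a * f $ k) / 2 * ((1 + a * r' $ k) / (1 + a * r $ k))) \<le> 3"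
      by (simp add: p_def)
  qed (use r in auto)
qed

text \<open>The gradient of the one-qubit log-likelihood at r. Together with
  \<open>score_const\<close> it gives the Pauli coordinates of the operator R.\<close>

definition score :: "real^3 \<Rightarrow> real^3 \<Rightarrow> real^3" where
  "score f r = (\<chi> k. \<Sum>a\<in>{1, - 1}. a * ((1 + a * f $ k) / 2 / (1 + a * r $ k)))"

definition score_const :: "real^3 \<Rightarrow> real^3 \<Rightarrow> real" where
  "score_const f r = (\<Sum>k\<in>UNIV. \<Sum>a\<in>{1, - 1}. (1 + a * f $ k) / 2 / (1 + a * r $ k))"

lemma score_sum:
  "(\<Sum>k\<in>UNIV. \<Sum>a\<in>{1, - 1}. (1 + a * f $ k) / 2 * ((1 + a * r' $ k) / (1 + a * r $ k)))
    = score_const f r + score f r \<bullet> r'"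
  by (simp add: score_const_def score_def inner_vec3 sum_3 add_divide_distrib diff_divide_distrib algebra_simps)

text \<open>Away from the poles this is a common denominator. At a pole of r the positivity clause
  of \<open>qubit_ml\<close> forces the datum to be deterministic too, so both sides vanish. The
  value 3 arises because at r' = r all ratios of positive weight are 1.\<close>

lemma score_component:
  assumes f: "\<And>k. \<bar>f $ k\<bar> \<le> 1" and ml: "qubit_ml f r"
  shows "score f r $ k * (1 - (r $ k)\<^sup>2) = f $ k - r $ k"
    and "\<bar>r $ k\<bar> = 1 \<Longrightarrow> f $ k = r $ k"
    and "score_const f r + score f r \<bullet> r = 3"
proof -
  have pos: "0 < 1 + a * f $ k \<Longrightarrow> 0 < 1 + a * r $ k" if "a \<in> {1, - 1}" for k a
    using ml that unfolding qubit_ml_def by blast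
  show edge: "f $ k = r $ k" if "\<bar>r $ k\<bar> = 1" for k
    using that pos[of 1 k] pos[of "- 1" k] f[of k] by (smt (verit) insertI1 insertI2)
  show "score f r $ k * (1 - (r $ k)\<^sup>2) = f $ k - r $ k"
  proof (cases "\<bar>r $ k\<bar> = 1")
    case True
    then show ?thesis using edge[of k] by (simp add: power2_eq_1_iff abs_if split: if_splits)
  next
    case False
    then have "1 + r $ k \<noteq> 0" "1 - r $ k \<noteq> 0" by auto
    moreover have "1 - (r $ k)\<^sup>2 = (1 + r $ k) * (1 - r $ k)"
      by (simp add: power2_eq_square algebra_simps)
    ultimately show ?thesis
      by (simp add: score_def diff_divide_eq_iff divide_diff_eq_iff divide_simps)
        (simp add: algebra_simps power2_eq_square)
  qed
  have "(1 + a * f $ k) / 2 * ((1 + a * r $ k) / (1 + a * r $ k)) = (1 + a * f $ k) / 2"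
    if a: "a \<in> {1, - 1}" for a k
  proof (cases "1 + a * f $ k = 0")
    case False
    then have "0 < 1 + a * f $ k" using f[of k] a by auto
    then show ?thesis using pos[OF a, of k] by simp
  qed simp
  then have "score_const f r + score f r \<bullet> r = (\<Sum>k\<in>UNIV. \<Sum>a\<in>{1, - 1}. (1 + a * f $ k) / 2)"
    unfolding score_sum[symmetric] by (intro sum.cong) auto
  then show "score_const f r + score f r \<bullet> r = 3"
    by (simp add: sum_3 field_simps)
qed

text \<open>Either the gradient of the likelihood vanishes at \<open>r\<close>, or it points along \<open>r\<close> and \<open>norm r = 1\<close>.\<close>
lemma qubit_ml_outside:
  assumes f: "\<And>k. \<bar>f $ k\<bar> \<le> 1" and ml: "qubit_ml f r" and out: "norm f > 1"
  shows "norm r = 1" "(r $ k)\<^sup>2 \<le> r $ k * f $ k"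
proof -
  note comp = score_component[OF f ml]
  define g where "g = score f r"
  have r: "norm r \<le> 1" using ml by (simp add: qubit_ml_def)
  have "g \<bullet> r' \<le> g \<bullet> r" if "norm r' \<le> 1" for r'
  proof -
    have "score_const f r + g \<bullet> r' \<le> 3"
      using ml that unfolding qubit_ml_def score_sum g_def by blast
    then show ?thesis using comp(3) by (simp add: g_def)
  qed
  moreover have "g \<bullet> sgn g = norm g"
    by (simp add: sgn_div_norm dot_square_norm power2_eq_square field_simps)
  \<comment> \<open>The linear functional given by g is largest over the ball at r; it is compared
    with its value at \<open>sgn g\<close>.\<close>
  ultimately have "norm g \<le> g \<bullet> r"
    by (metis norm_sgn order_refl zero_le_one)
  moreover have "g \<noteq> 0"
  proof
    assume "g = 0"
    then have "f = r" using comp(1) by (simp add: vec_eq_iff g_def)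
    then show False using out r by simp
  qed
  moreover have "g \<bullet> r \<le> norm g * norm r" by (rule norm_cauchy_schwarz)
  ultimately have "norm g * 1 \<le> norm g * norm r" and "norm g > 0"
    unfolding mult_1_right zero_less_norm_iff by linarith+
  then show r1: "norm r = 1"
    using r mult_le_cancel_left_pos[of "norm g" 1 "norm r"] by auto
  then have "g \<bullet> r = norm g * norm r"
    using \<open>norm g \<le> g \<bullet> r\<close> norm_cauchy_schwarz[of g r] by simp
  \<comment> \<open>Equality in Cauchy-Schwarz: this is the Lagrange condition, with multiplier
    \<open>norm g\<close>.\<close>
  then have "norm g *\<^sub>R r = g"
    using norm_cauchy_schwarz_eq[of g r] r1 by simp
  then have gk: "norm g * r $ k = g $ k"
    using vector_scaleR_component[of "norm g" r k] by simp
  have "r $ k * f $ k - (r $ k)\<^sup>2 = r $ k * (g $ k * (1 - (r $ k)\<^sup>2))"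
    unfolding g_def comp(1) by (simp add: power2_eq_square algebra_simps)
  also have "\<dots> = norm g * (r $ k)\<^sup>2 * (1 - (r $ k)\<^sup>2)"
    by (simp add: gk[symmetric] power2_eq_square mult_ac)
  also have "\<dots> \<ge> 0"
    using abs_component_le_1[OF r, of k] by (intro mult_nonneg_nonneg) (auto simp: abs_square_le_1)
  finally show "(r $ k)\<^sup>2 \<le> r $ k * f $ k" by simp
qed

section \<open>The fidelity bound for one qubit\<close>

text \<open>Split b and t into parts along a and orthogonal to a. The orthogonal part of b has norm
  at most s, and Cauchy-Schwarz bounds its product with that of t. The extra factor
  \<open>a \<bullet> t\<close> avoids a case distinction on its sign.\<close>

lemma unit_vectors_inner_bound:
  fixes a b t :: "'a::real_inner"
  assumes a: "norm a = 1" and b: "norm b = 1" and ab: "c \<le> a \<bullet> b"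
    and c: "0 \<le> c" and s: "0 \<le> s" and cs: "c\<^sup>2 + s\<^sup>2 = 1"
  shows "c * (a \<bullet> t)\<^sup>2 - s * (\<bar>a \<bullet> t\<bar> * sqrt ((norm t)\<^sup>2 - (a \<bullet> t)\<^sup>2)) \<le> (a \<bullet> t) * (b \<bullet> t)"
proof -
  define d where "d = a \<bullet> b"
  define w where "w = b - d *\<^sub>R a"
  define u where "u = t - (a \<bullet> t) *\<^sub>R a"
  have aa: "a \<bullet> a = 1" "b \<bullet> b = 1" using a b by (simp_all add: norm_eq_1)
  have w: "(norm w)\<^sup>2 = 1 - d\<^sup>2" unfolding power2_norm_eq_inner
    by (simp add: w_def inner_diff aa d_def inner_commute power2_eq_square)
  have u: "(norm u)\<^sup>2 = (norm t)\<^sup>2 - (a \<bullet> t)\<^sup>2" unfolding power2_norm_eq_inner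
    by (simp add: u_def inner_diff aa inner_commute power2_eq_square)
  have bt: "b \<bullet> t = d * (a \<bullet> t) + w \<bullet> u"
    by (simp add: w_def u_def inner_diff aa d_def inner_commute)
  have "c\<^sup>2 \<le> d\<^sup>2" using c ab by (intro power_mono) (auto simp: d_def)
  then have "(norm w)\<^sup>2 \<le> s\<^sup>2" using w cs by simp
  then have "norm w \<le> s" using s by (rule power2_le_imp_le)
  moreover have "norm u = sqrt ((norm t)\<^sup>2 - (a \<bullet> t)\<^sup>2)"
    by (simp flip: u)
  moreover have "\<bar>w \<bullet> u\<bar> \<le> norm w * norm u" by (rule Cauchy_Schwarz_ineq2)
  ultimately have "\<bar>w \<bullet> u\<bar> \<le> s * sqrt ((norm t)\<^sup>2 - (a \<bullet> t)\<^sup>2)"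
    by (metis mult_right_mono norm_ge_zero order_trans)
  then have "\<bar>a \<bullet> t\<bar> * \<bar>w \<bullet> u\<bar> \<le> \<bar>a \<bullet> t\<bar> * (s * sqrt ((norm t)\<^sup>2 - (a \<bullet> t)\<^sup>2))"
    by (intro mult_left_mono) auto
  moreover have "- (\<bar>a \<bullet> t\<bar> * \<bar>w \<bullet> u\<bar>) \<le> (a \<bullet> t) * (w \<bullet> u)"
    by (metis abs_ge_minus_self abs_mult minus_le_iff)
  moreover have "c * (a \<bullet> t)\<^sup>2 \<le> d * (a \<bullet> t)\<^sup>2"
    using ab by (intro mult_right_mono) (auto simp: d_def)
  moreover have "(a \<bullet> t) * (b \<bullet> t) = d * (a \<bullet> t)\<^sup>2 + (a \<bullet> t) * (w \<bullet> u)"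
    by (simp add: bt power2_eq_square algebra_simps)
  ultimately show ?thesis by (simp add: mult_ac)
qed

text \<open>Cauchy-Schwarz: the radicands sum to 3 Q minus the squared norm of x, hence to at most
  twice that squared norm. This is the origin of sqrt 2.\<close>

lemma sum_mult_sqrt_bound:
  fixes x :: "real^3"
  assumes "\<And>k. (x $ k)\<^sup>2 \<le> Q" and "Q \<le> (norm x)\<^sup>2"
  shows "(\<Sum>k\<in>UNIV. \<bar>x $ k\<bar> * sqrt (Q - (x $ k)\<^sup>2)) \<le> sqrt 2 * (norm x)\<^sup>2"
proof -
  have "(\<Sum>k\<in>UNIV. \<bar>x $ k\<bar> * sqrt (Q - (x $ k)\<^sup>2))\<^sup>2
      \<le> (\<Sum>k\<in>UNIV. \<bar>x $ k\<bar>\<^sup>2) * (\<Sum>k\<in>UNIV. (sqrt (Q - (x $ k)\<^sup>2))\<^sup>2)"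
    by (rule Cauchy_Schwarz_ineq_sum)
  also have "\<dots> = (norm x)\<^sup>2 * (3 * Q - (norm x)\<^sup>2)"
    using assms(1) unfolding norm_vec3 by (simp add: sum_3)
  also have "\<dots> \<le> (norm x)\<^sup>2 * (2 * (norm x)\<^sup>2)"
    using assms(2) by (intro mult_left_mono) auto
  also have "\<dots> = (sqrt 2 * (norm x)\<^sup>2)\<^sup>2"
    by (simp add: power2_eq_square)
  finally show ?thesis
    by (rule power2_le_imp_le) simp
qed

text \<open>Here c and s stand for the cosine and sine of the largest angle. The componentwise bound
  is summed over whichever of t and f is longer if f is in the ball, and over r otherwise.\<close>

lemma qubit_fidelity_bound:
  fixes t :: "real^3" and n :: "3 \<Rightarrow> real^3"
  assumes n: "\<And>k. norm (n k) = 1" "\<And>k. c \<le> n k $ k"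
    and c: "0 \<le> c" and s: "0 \<le> s" and cs: "c\<^sup>2 + s\<^sup>2 = 1"
    and t: "norm t \<le> 1" and f: "f = (\<chi> k. n k \<bullet> t)"
    and r: "norm f \<le> 1 \<longrightarrow> r = f" "norm f > 1 \<longrightarrow> norm r = 1 \<and> (\<forall>k. (r $ k)\<^sup>2 \<le> r $ k * f $ k)"
  shows "c - sqrt 2 * s \<le> t \<bullet> r + sqrt ((1 - (norm t)\<^sup>2) * (1 - (norm r)\<^sup>2))"
proof -
  define m where "m = c - sqrt 2 * s"
  define q where "q = (norm t)\<^sup>2"
  have "c\<^sup>2 \<le> 1\<^sup>2" unfolding power_one using cs zero_le_power2[of s] by linarith
  then have "c \<le> 1" by (rule power2_le_imp_le) simp
  moreover have "0 \<le> sqrt 2 * s" using s by simp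
  ultimately have m1: "m \<le> 1" by (simp add: m_def)
  have q1: "q \<le> 1" using t by (simp add: q_def power_le_one)
  have ax: "axis k 1 \<bullet> t = t $ k" "norm (axis k (1::real)) = 1" "n k \<bullet> axis k 1 = n k $ k"
    "axis k 1 \<bullet> n k = n k $ k" for k
    by (simp_all add: inner_axis inner_axis' inner_commute)
  have tk: "c * (t $ k)\<^sup>2 - s * (\<bar>t $ k\<bar> * sqrt (q - (t $ k)\<^sup>2)) \<le> t $ k * f $ k" for k
    using unit_vectors_inner_bound[of "axis k 1" "n k" c s t] n c s cs by (simp add: ax f q_def)
  have fk: "c * (f $ k)\<^sup>2 - s * (\<bar>f $ k\<bar> * sqrt (q - (f $ k)\<^sup>2)) \<le> f $ k * t $ k" for k
    using unit_vectors_inner_bound[of "n k" "axis k 1" c s t] n c s cs by (simp add: ax f q_def)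
  have tq: "(t $ k)\<^sup>2 \<le> q" for k
    using component_le_norm_cart[of t k] by (simp add: q_def abs_le_square_iff[symmetric])
  have fq: "(f $ k)\<^sup>2 \<le> q" for k
    using Cauchy_Schwarz_ineq2[of "n k" t] n(1)[of k] by (simp add: f q_def abs_le_square_iff[symmetric])
  \<comment> \<open>Below, x is t, f or r, with Q = q, q or 1 respectively; in each case Q is at
    most the squared norm of x.\<close>
  have bound: "m * (norm x)\<^sup>2 \<le> (\<Sum>k\<in>UNIV. y k)"
    if "\<And>k. c * (x $ k)\<^sup>2 - s * (\<bar>x $ k\<bar> * sqrt (Q - (x $ k)\<^sup>2)) \<le> y k"
      "\<And>k. (x $ k)\<^sup>2 \<le> Q" "Q \<le> (norm x)\<^sup>2" for x :: "real^3" and y Q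
  proof -
    have "s * (\<Sum>k\<in>UNIV. \<bar>x $ k\<bar> * sqrt (Q - (x $ k)\<^sup>2)) \<le> s * (sqrt 2 * (norm x)\<^sup>2)"
      using that s by (intro mult_left_mono sum_mult_sqrt_bound) auto
    then have "m * (norm x)\<^sup>2 \<le> c * (norm x)\<^sup>2 - s * (\<Sum>k\<in>UNIV. \<bar>x $ k\<bar> * sqrt (Q - (x $ k)\<^sup>2))"
      by (simp add: m_def algebra_simps)
    also have "\<dots> = (\<Sum>k\<in>UNIV. c * (x $ k)\<^sup>2 - s * (\<bar>x $ k\<bar> * sqrt (Q - (x $ k)\<^sup>2)))"
      unfolding norm_vec3 by (simp add: sum_3 algebra_simps)
    also have "\<dots> \<le> (\<Sum>k\<in>UNIV. y k)" by (intro sum_mono that)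
    finally show ?thesis .
  qed
  have mix: "m \<le> m * x + (1 - x)" if "x \<le> 1" for x
  proof -
    have "0 \<le> (1 - m) * (1 - x)" using m1 that by (intro mult_nonneg_nonneg) auto
    then show ?thesis by (simp add: algebra_simps)
  qed
  have "m \<le> t \<bullet> r + sqrt ((1 - q) * (1 - (norm r)\<^sup>2))"
  proof (cases "norm f \<le> 1")
    case True
    then have rf: "r = f" and p1: "(norm f)\<^sup>2 \<le> 1" using r by (auto simp: power_le_one)
    show ?thesis
    proof (cases "(norm f)\<^sup>2 \<le> q")
      case True
      have "m * q \<le> t \<bullet> f"
        using bound[OF tk tq] by (simp add: q_def inner_vec_def)
      \<comment> \<open>The smaller of the two factors bounds the root from below, and
        \<open>mix\<close> then absorbs the missing weight 1 - q. The other case exchanges the roles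
        of t and f.\<close>
      moreover have "sqrt ((1 - q)\<^sup>2) \<le> sqrt ((1 - q) * (1 - (norm f)\<^sup>2))"
        unfolding power2_eq_square[of "1 - q"] using True q1 by (intro real_sqrt_le_mono mult_left_mono) auto
      ultimately show ?thesis using mix[OF q1] q1 by (simp add: rf)
    next
      case False
      have "m * (norm f)\<^sup>2 \<le> t \<bullet> f"
        using bound[OF fk fq] False by (simp add: inner_vec_def mult.commute)
      moreover have "sqrt ((1 - (norm f)\<^sup>2)\<^sup>2) \<le> sqrt ((1 - q) * (1 - (norm f)\<^sup>2))"
        unfolding power2_eq_square[of "1 - (norm f)\<^sup>2"] using False p1 by (intro real_sqrt_le_mono mult_right_mono) auto
      ultimately show ?thesis using mix[OF p1] p1 by (simp add: rf)
    qed
  next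
    case False
    then have r1: "norm r = 1" and rf: "\<And>k. (r $ k)\<^sup>2 \<le> r $ k * f $ k" using r by auto
    have "c * (r $ k)\<^sup>2 - s * (\<bar>r $ k\<bar> * sqrt (1 - (r $ k)\<^sup>2)) \<le> t $ k * r $ k" for k
    proof (cases "r $ k = 0")
      case False
      \<comment> \<open>The Lagrange inequality makes this ratio at least 1. Dividing the bound for
        \<open>f $ k\<close> by it replaces one factor \<open>f $ k\<close> by \<open>r $ k\<close>;
        the remaining occurrences are removed by monotonicity, as \<open>r $ k\<close> is no larger
        in absolute value.\<close>
      define \<mu> where "\<mu> = f $ k / r $ k"
      have f\<mu>: "f $ k = \<mu> * r $ k" using False by (simp add: \<mu>_def)
      then have "(r $ k)\<^sup>2 * 1 \<le> (r $ k)\<^sup>2 * \<mu>" using rf[of k] by (simp add: power2_eq_square mult_ac)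
      then have \<mu>: "1 \<le> \<mu>" using False mult_le_cancel_left_pos[of "(r $ k)\<^sup>2" 1 \<mu>] by simp
      have rf2: "(r $ k)\<^sup>2 \<le> (f $ k)\<^sup>2"
        using \<mu> mult_mono[of 1 "\<mu>\<^sup>2" "(r $ k)\<^sup>2" "(r $ k)\<^sup>2"] by (simp add: f\<mu> power_mult_distrib)
      have "\<mu> * (c * (r $ k * f $ k) - s * (\<bar>r $ k\<bar> * sqrt (q - (f $ k)\<^sup>2))) \<le> \<mu> * (t $ k * r $ k)"
        using fk[of k] \<mu> by (simp add: f\<mu> abs_mult power2_eq_square algebra_simps)
      then have "c * (r $ k * f $ k) - s * (\<bar>r $ k\<bar> * sqrt (q - (f $ k)\<^sup>2)) \<le> t $ k * r $ k"
        using \<mu> by simp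
      moreover have "c * (r $ k)\<^sup>2 \<le> c * (r $ k * f $ k)"
        using rf c by (intro mult_left_mono) auto
      moreover have "s * (\<bar>r $ k\<bar> * sqrt (q - (f $ k)\<^sup>2)) \<le> s * (\<bar>r $ k\<bar> * sqrt (1 - (r $ k)\<^sup>2))"
        using s q1 rf2 by (intro mult_left_mono real_sqrt_le_mono) auto
      ultimately show ?thesis by linarith
    qed simp
    from bound[OF this] have "m \<le> t \<bullet> r"
      using abs_component_le_1[of r] r1 by (simp add: inner_vec_def abs_square_le_1)
    then show ?thesis by (simp add: r1)
  qed
  then show ?thesis by (simp add: m_def q_def)
qed

section \<open>Maximum likelihood for several qubits\<close>

lemma outcome_proj_pauli: "outcome_proj a (pauli k) = pauli_mat (1 / 2) ((a / 2) *\<^sub>R axis k 1)"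
  by (metis dot_sigma_axis outcome_proj_pauli_mat)

text \<open>Needed because \<open>outcome_prob\<close> keeps only real parts, while the uniqueness
  argument needs equality of complex traces.\<close>

lemma trace_hermitian_mult_real:
  assumes "adjoint_mat A = A" "adjoint_mat B = B"
  shows "Im (trace (A ** B)) = 0"
proof -
  have "cnj (trace (A ** B)) = trace (adjoint_mat (A ** B))"
    by (simp add: trace_def)
  also have "\<dots> = trace (A ** B)"
    using trace_mul_sym[of A B] by (simp add: adjoint_mat_mult assms)
  finally show ?thesis by (simp add: complex_eq_iff)
qed

lemma outcome_prob_tensor_bloch:
  "outcome_prob (\<lambda>j k. dot_sigma (n j k)) (tensor (\<lambda>j. bloch_state (t j))) k a
    = (\<Prod>j\<in>UNIV. (1 + a j * (n j (k j) \<bullet> t j)) / 2)"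
proof -
  have "trace (bloch_state (t j) ** outcome_proj (a j) (dot_sigma (n j (k j))))
      = of_real ((1 + a j * (n j (k j) \<bullet> t j)) / 2)" for j
    by (simp add: complex_eq_iff bloch_state_pauli_mat outcome_proj_pauli_mat
        trace_pauli_mat_mult Im_trace_pauli_mat_mult inner_commute field_simps)
  then show ?thesis
    by (simp add: outcome_prob_def tensor_mult trace_tensor flip: of_real_prod del: of_real_divide of_real_add of_real_mult)
qed

lemma outcome_prob_pauli_tensor_bloch:
  "outcome_prob (\<lambda>j. pauli) (tensor (\<lambda>j. bloch_state (t j))) k a
    = (\<Prod>j\<in>UNIV. (1 + a j * t j $ k j) / 2)"
  using outcome_prob_tensor_bloch[of "\<lambda>j k. axis k 1" t k a] by (simp add: dot_sigma_axis inner_axis')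

lemma finite_outcomes: "finite outcomes"
  unfolding outcomes_PiE by (intro finite_PiE) auto

text \<open>Expand each factor in its two eigenprojectors, with eigenvalues \<open>x \<plusminus> norm v\<close>.\<close>
lemma Re_trace_density_tensor_le:
  fixes x :: "'n::finite \<Rightarrow> real"
  assumes \<rho>: "density_mat \<rho>" and v: "\<And>j. norm (v j) \<le> x j" "\<And>j. x j + norm (v j) \<le> B"
  shows "Re (trace (\<rho> ** tensor (\<lambda>j. pauli_mat (x j) (v j)))) \<le> B ^ CARD('n)"
proof -
  let ?S = "{1, - 1 :: real}"
  define I where "I = Pi\<^sub>E (UNIV :: 'n set) (\<lambda>_. ?S)"
  have "\<exists>h. norm h = 1 \<and> v j = norm (v j) *\<^sub>R h" for j
  proof (cases "v j = 0")
    case True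
    then show ?thesis by (intro exI[of _ "axis 1 1"]) simp
  next
    case False
    then show ?thesis by (intro exI[of _ "sgn (v j)"]) (simp add: norm_sgn sgn_div_norm)
  qed
  then obtain h where h: "\<And>j. norm (h j) = 1" "\<And>j. norm (v j) *\<^sub>R h j = v j"
    by metis
  define T where "T b = tensor (\<lambda>j. spin_proj (b j *\<^sub>R h j))" for b
  have T: "0 \<le> Re (trace (\<rho> ** T b))" if "b \<in> I" for b
  proof -
    have "norm (b j *\<^sub>R h j) = 1" for j
      using that h(1)[of j] by (auto simp: I_def PiE_def Pi_def dest: spec[of _ j])
    then have "T b ** T b = T b"
      unfolding T_def tensor_mult by (simp add: spin_proj_idem)
    moreover have "adjoint_mat (T b) = T b"
      by (simp add: T_def adjoint_mat_tensor spin_proj_def)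
    ultimately show ?thesis
      using Re_trace_psd_mat_square_nonneg[of \<rho> "T b"] \<rho> by (simp add: density_mat_def)
  qed
  have "(\<Sum>b\<in>?S. mat (of_real (x j + b * norm (v j))) ** spin_proj (b *\<^sub>R h j)) = pauli_mat (x j) (v j)" for j
  proof -
    have "(\<Sum>b\<in>?S. mat (of_real (x j + b * norm (v j))) ** spin_proj (b *\<^sub>R h j))
        = pauli_mat (x j) (norm (v j) *\<^sub>R h j)"
      unfolding spin_proj_def pauli_mat_scale
      by (simp add: pauli_mat_add) (intro arg_cong2[of _ _ _ _ pauli_mat], simp_all add: vec_eq_iff field_simps)
    then show ?thesis by (simp add: h)
  qed
  then have "trace (\<rho> ** tensor (\<lambda>j. pauli_mat (x j) (v j)))
      = (\<Sum>b\<in>I. of_real (\<Prod>j\<in>UNIV. x j + b j * norm (v j)) * trace (\<rho> ** T b))"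
    using trace_tensor_sum[of ?S \<rho> "\<lambda>j b. of_real (x j + b * norm (v j))" "\<lambda>j b. spin_proj (b *\<^sub>R h j)"]
    by (simp add: I_def T_def)
  then have "Re (trace (\<rho> ** tensor (\<lambda>j. pauli_mat (x j) (v j))))
      = (\<Sum>b\<in>I. (\<Prod>j\<in>UNIV. x j + b j * norm (v j)) * Re (trace (\<rho> ** T b)))"
    by (simp del: of_real_prod of_real_add of_real_mult)
  also have "\<dots> \<le> (\<Sum>b\<in>I. B ^ CARD('n) * Re (trace (\<rho> ** T b)))"
  proof (intro sum_mono mult_right_mono T)
    fix b assume b: "b \<in> I"
    have "0 \<le> x j + b j * norm (v j) \<and> x j + b j * norm (v j) \<le> B" for j
    proof -
      have "b j = 1 \<or> b j = - 1" using b by (auto simp: I_def PiE_def Pi_def)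
      then show ?thesis using v[of j] norm_ge_zero[of "v j"]
        by (elim disjE; simp only: mult_1 mult_minus1; intro conjI; linarith)
    qed
    then have "(\<Prod>j\<in>UNIV. x j + b j * norm (v j)) \<le> (\<Prod>j\<in>(UNIV :: 'n set). B)"
      by (intro prod_mono) auto
    then show "(\<Prod>j\<in>UNIV. x j + b j * norm (v j)) \<le> B ^ CARD('n)" by simp
  qed
  also have "\<dots> = B ^ CARD('n) * Re (\<Sum>b\<in>I. trace (\<rho> ** T b))"
    by (simp add: sum_distrib_left)
  \<comment> \<open>The eigenprojectors of each factor resolve the identity, so the weights sum to
    the trace of \<rho>.\<close>
  also have "(\<Sum>b\<in>I. trace (\<rho> ** T b)) = 1"
  proof -
    have "(\<Sum>b\<in>?S. mat 1 ** spin_proj (b *\<^sub>R h j)) = mat 1" for j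
      by (simp add: spin_proj_def pauli_mat_add pauli_mat_1_0)
    then have "trace (\<rho> ** tensor (\<lambda>j. mat 1)) = (\<Sum>b\<in>I. trace (\<rho> ** T b))"
      using trace_tensor_sum[of ?S \<rho> "\<lambda>j b. 1" "\<lambda>j b. spin_proj (b *\<^sub>R h j)"]
      by (simp add: I_def T_def)
    then show ?thesis using \<rho> by (simp add: tensor_mat_1 density_mat_def)
  qed
  finally show ?thesis by simp
qed

text \<open>The left side is the operator R: the coefficients are ratios of measured to predicted
  probabilities, in which the factors 1/2 cancel.\<close>

lemma qubit_ml_operator:
  "(\<Sum>k\<in>UNIV. \<Sum>a\<in>{1, - 1}. mat (of_real ((1 + a * f $ k) / (1 + a * r $ k))) ** outcome_proj a (pauli k))
    = pauli_mat (score_const f r) (score f r)"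
proof -
  define c where "c k a = (1 + a * f $ k) / (1 + a * r $ k)" for k a
  have "(\<Sum>k\<in>UNIV. \<Sum>a\<in>{1, - 1}. mat (of_real (c k a)) ** outcome_proj a (pauli k))
      = pauli_mat (\<Sum>k\<in>UNIV. \<Sum>a\<in>{1, - 1}. c k a / 2) (\<Sum>k\<in>UNIV. \<Sum>a\<in>{1, - 1}. (a * c k a / 2) *\<^sub>R axis k 1)"
    unfolding outcome_proj_pauli pauli_mat_scale
    by (simp add: sum_3 pauli_mat_add mult.commute)
  moreover have "(\<Sum>k\<in>UNIV. \<Sum>a\<in>{1, - 1}. c k a / 2) = score_const f r"
    by (simp add: score_const_def c_def mult.commute)
  moreover have "(\<Sum>k\<in>UNIV. \<Sum>a\<in>{1, - 1}. (a * c k a / 2) *\<^sub>R axis k 1) = score f r"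
    by (simp add: vec_eq_iff forall_3 sum_3 axis_def score_def c_def mult.commute)
  ultimately show ?thesis by (simp add: c_def)
qed

text \<open>These say that the eigenvalues of R lie between 0 and 3. They follow by evaluating the
  affine function of r' in \<open>qubit_ml\<close> at plus and minus the normalized score; it is
  nonnegative on the ball since all its terms are.\<close>

lemma score_norm_bounds:
  assumes f: "\<And>k. \<bar>f $ k\<bar> \<le> 1" and ml: "qubit_ml f r"
  shows "norm (score f r) \<le> score_const f r" "score_const f r + norm (score f r) \<le> 3"
proof -
  have r: "norm r \<le> 1" using ml by (simp add: qubit_ml_def)
  have gs: "score f r \<bullet> sgn (score f r) = norm (score f r)"
    by (simp add: sgn_div_norm dot_square_norm power2_eq_square field_simps)
  have s: "norm (sgn (score f r)) \<le> 1" by (simp add: norm_sgn)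
  show "score_const f r + norm (score f r) \<le> 3"
    using ml s gs unfolding qubit_ml_def score_sum by metis
  have "0 \<le> score_const f r + score f r \<bullet> r'" if "norm r' \<le> 1" for r'
    unfolding score_sum[symmetric]
  proof (intro sum_nonneg)
    fix k and a :: real assume a: "a \<in> {1, - 1}"
    have "0 \<le> 1 + a * f $ k" using f[of k] a by auto
    then show "0 \<le> (1 + a * f $ k) / 2 * ((1 + a * r' $ k) / (1 + a * r $ k))"
      using signed_component_nonneg[OF that a, of k] signed_component_nonneg[OF r a, of k] by simp
  qed
  from this[of "- sgn (score f r)"] show "norm (score f r) \<le> score_const f r"
    using s gs by simp
qed

text \<open>
  Every \<open>2 \<times> 2\<close> matrix is a combination of the projectors of positive probability. A setting with
  two possible outcomes yields the identity, and for each other setting one outcome suffices.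
\<close>
lemma outcome_proj_span:
  fixes M :: "complex^2^2" and f :: "real^3"
  assumes k0: "\<bar>f $ k0\<bar> < 1"
  shows "\<exists>c. M = (\<Sum>k\<in>UNIV. \<Sum>a\<in>{1, - 1}. mat (c k a) ** outcome_proj a (pauli k)) \<and>
    (\<forall>k. \<forall>a\<in>{1, - 1}. 1 + a * f $ k = 0 \<longrightarrow> c k a = 0)"
proof -
  define m0 where "m0 = (M $ 1 $ 1 + M $ 2 $ 2) / 2"
  define m :: "complex^3" where "m = vector [(M $ 1 $ 2 + M $ 2 $ 1) / 2,
    \<i> * (M $ 1 $ 2 - M $ 2 $ 1) / 2, (M $ 1 $ 1 - M $ 2 $ 2) / 2]"
  \<comment> \<open>An outcome of positive probability for setting k. As its projector is (1 + b
    sigma_k) / 2, taking it 2 b m times gives m sigma_k plus b m times the identity. The surplus is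
    removed by \<open>d\<close>, which adds multiples of the identity through both outcomes of
    \<open>k0\<close>.\<close>
  define b :: "3 \<Rightarrow> real" where "b k = (if f $ k \<ge> 0 then 1 else - 1)" for k
  define d where "d k = (if k = k0 then m0 - (\<Sum>k\<in>UNIV. of_real (b k) * m $ k) else 0)" for k
  define c where "c k a = d k + (if a = b k then 2 * of_real (b k) * m $ k else 0)" for k a
  have proj: "outcome_proj a (pauli k) $ i $ j = ((if i = j then 1 else 0) + of_real a * pauli k $ i $ j) / 2" for a k i j
    by (simp add: outcome_proj_def mat_def scaleR_conv_of_real[where 'a = complex])
  have "(\<Sum>a\<in>{1, - 1}. mat (c k a) ** outcome_proj a (pauli k)) $ i $ j
      = (if i = j then d k + of_real (b k) * m $ k else 0) + m $ k * pauli k $ i $ j" for k i j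
    by (simp add: proj c_def b_def field_simps)
  then have "(\<Sum>k\<in>UNIV. \<Sum>a\<in>{1, - 1}. mat (c k a) ** outcome_proj a (pauli k)) $ i $ j
      = (if i = j then (\<Sum>k\<in>UNIV. d k) + (\<Sum>k\<in>UNIV. of_real (b k) * m $ k) else 0)
        + (\<Sum>k\<in>UNIV. m $ k * pauli k $ i $ j)" for i j
    by (simp only: sum_component) (simp add: sum.distrib)
  moreover have "(\<Sum>k\<in>UNIV. d k) = m0 - (\<Sum>k\<in>UNIV. of_real (b k) * m $ k)"
    by (simp add: d_def)
  ultimately have "(\<Sum>k\<in>UNIV. \<Sum>a\<in>{1, - 1}. mat (c k a) ** outcome_proj a (pauli k)) $ i $ j
      = (if i = j then m0 else 0) + (\<Sum>k\<in>UNIV. m $ k * pauli k $ i $ j)" for i j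
    by simp
  moreover have "M $ i $ j = (if i = j then m0 else 0) + (\<Sum>k\<in>UNIV. m $ k * pauli k $ i $ j)" for i j
    using exhaust_2[of i] exhaust_2[of j]
    by (auto simp: sum_3 m_def m0_def pauli_def sigma_x_def sigma_y_def sigma_z_def field_simps)
  moreover have "c k a = 0" if "1 + a * f $ k = 0" "a \<in> {1, - 1}" for k a
    using that k0 by (auto simp: c_def d_def b_def abs_if split: if_splits)
  ultimately show ?thesis by (intro exI[of _ c]) (simp only: vec_eq_iff, blast)
qed

section \<open>The product state as the unique maximizer\<close>

context
  fixes f r :: "'n::finite \<Rightarrow> real^3" and P :: "('n \<Rightarrow> 3) \<Rightarrow> ('n \<Rightarrow> real) \<Rightarrow> real"
  assumes f: "\<And>j k. \<bar>f j $ k\<bar> \<le> 1" and ml: "\<And>j. qubit_ml (f j) (r j)"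
    and P: "\<And>k a. P k a = (\<Prod>j\<in>UNIV. (1 + a j * f j $ k j) / 2)"
begin

abbreviation "prob \<equiv> outcome_prob (\<lambda>j. pauli)"
abbreviation "runs \<equiv> (UNIV :: ('n \<Rightarrow> 3) set) \<times> (outcomes :: ('n \<Rightarrow> real) set)"
abbreviation "\<rho>\<^sub>0 \<equiv> tensor (\<lambda>j. bloch_state (r j))"

lemma finite_runs: "finite runs"
  by (intro finite_cartesian_product finite_outcomes) simp

lemma data_nonneg: "a \<in> outcomes \<Longrightarrow> 0 \<le> P k a"
  unfolding P
proof (intro prod_nonneg ballI)
  fix j assume "a \<in> outcomes"
  then have "a j = 1 \<or> a j = - 1" by (auto simp: outcomes_def)
  then show "0 \<le> (1 + a j * f j $ k j) / 2" using f[of j "k j"] by auto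
qed

lemma ml_prob_pos:
  assumes "a \<in> outcomes" "0 < P k a"
  shows "0 < prob \<rho>\<^sub>0 k a"
  unfolding outcome_prob_pauli_tensor_bloch
proof (intro prod_pos ballI)
  fix j
  have aj: "a j \<in> {1, - 1}" using assms(1) by (auto simp: outcomes_def)
  have "(1 + a j * f j $ k j) / 2 \<noteq> 0"
  proof
    assume "(1 + a j * f j $ k j) / 2 = 0"
    then have "P k a = 0" unfolding P by (intro prod_zero) auto
    then show False using assms(2) by simp
  qed
  then have "0 < 1 + a j * f j $ k j" using aj f[of j "k j"] by auto
  then have "0 < 1 + a j * r j $ k j"
    using ml[of j, unfolded qubit_ml_def] aj by blast
  then show "0 < (1 + a j * r j $ k j) / 2" by simp
qed

lemma data_sum: "(\<Sum>(k, a)\<in>runs. P k a) = 3 ^ CARD('n)"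
proof -
  have "(\<Sum>a\<in>outcomes. P k a) = 1" for k
  proof -
    have "(\<Sum>a\<in>outcomes. P k a) = (\<Prod>j\<in>UNIV. \<Sum>a\<in>{1, - 1}. (1 + a * f j $ k j) / 2)"
      unfolding P outcomes_PiE by (subst prod_sum_PiE) simp_all
    also have "\<dots> = 1" by (intro prod.neutral) (simp add: field_simps)
    finally show ?thesis .
  qed
  then show ?thesis by (simp add: card_fun flip: sum.cartesian_product)
qed

text \<open>The ratios factorize over the qubits, so the sum is the trace of \<rho> against the
  tensor product of the one-qubit operators R, whose spectra lie in [0, 3].\<close>

lemma likelihood_ratio_sum:
  assumes "density_mat \<rho>"
  shows "(\<Sum>(k, a)\<in>runs. P k a * (prob \<rho> k a / prob \<rho>\<^sub>0 k a)) \<le> 3 ^ CARD('n)"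
proof -
  define c where "c j k a = (1 + a * f j $ k) / (1 + a * r j $ k)" for j k a
  have "P k a * (prob \<rho> k a / prob \<rho>\<^sub>0 k a) = (\<Prod>j\<in>UNIV. c j (k j) (a j)) * prob \<rho> k a" for k a
    unfolding outcome_prob_pauli_tensor_bloch[of r k a] P c_def
    by (simp add: prod_dividef)
  then have "(\<Sum>(k, a)\<in>runs. P k a * (prob \<rho> k a / prob \<rho>\<^sub>0 k a))
      = (\<Sum>k\<in>UNIV. \<Sum>a\<in>outcomes. (\<Prod>j\<in>UNIV. c j (k j) (a j)) * prob \<rho> k a)"
    by (simp add: sum.cartesian_product)
  also have "\<dots> = Re (\<Sum>k\<in>UNIV. \<Sum>a\<in>outcomes. (\<Prod>j\<in>UNIV. of_real (c j (k j) (a j)))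
      * trace (\<rho> ** tensor (\<lambda>j. outcome_proj (a j) (pauli (k j)))))"
    by (simp add: outcome_prob_def flip: of_real_prod)
  also have "\<dots> = Re (trace (\<rho> ** tensor (\<lambda>j. pauli_mat (score_const (f j) (r j)) (score (f j) (r j)))))"
    unfolding qubit_ml_operator[symmetric]
    by (subst trace_tensor_sum_outcomes) (simp only: c_def)
  also have "\<dots> \<le> 3 ^ CARD('n)"
    using score_norm_bounds[OF f ml] by (intro Re_trace_density_tensor_le assms)
  finally show ?thesis .
qed

lemma log_likelihood_runs:
  "log_likelihood P \<rho> = (\<Sum>(k, a)\<in>runs. ereal (P k a) * log_ext (prob \<rho> k a))"
  by (simp add: log_likelihood_def sum.cartesian_product)

lemma log_likelihood_finite:
  assumes "\<And>k a. a \<in> outcomes \<Longrightarrow> 0 < P k a \<Longrightarrow> 0 < prob \<rho> k a"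
  shows "log_likelihood P \<rho> = ereal (\<Sum>(k, a)\<in>runs. P k a * ln (prob \<rho> k a))"
proof -
  \<comment> \<open>Where P vanishes, both sides are 0, whatever \<open>ln\<close> yields at
    nonpositive arguments.\<close>
  have "ereal (P k a) * log_ext (prob \<rho> k a) = ereal (P k a * ln (prob \<rho> k a))" if "a \<in> outcomes" for k a
    using assms[OF that, of k] data_nonneg[OF that, of k]
    by (cases "P k a = 0") (auto simp: log_ext_def zero_ereal_def[symmetric] less_le)
  then have "log_likelihood P \<rho> = (\<Sum>ka\<in>runs. ereal (case ka of (k, a) \<Rightarrow> P k a * ln (prob \<rho> k a)))"
    unfolding log_likelihood_runs by (intro sum.cong) auto
  then show ?thesis by (simp only: sum_ereal)
qed

text \<open>One term is - \<infinity>. As \<infinity> would win a sum in \<open>ereal\<close>, the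
  remaining terms are first shown not to add up to \<infinity>.\<close>

lemma log_likelihood_infinite:
  assumes "a \<in> outcomes" "0 < P k a" "prob \<rho> k a \<le> 0"
  shows "log_likelihood P \<rho> = - \<infinity>"
proof -
  have "ereal (P k' a') * log_ext (prob \<rho> k' a') \<noteq> \<infinity>" if "a' \<in> outcomes" for k' a'
    using data_nonneg[OF that, of k'] by (auto simp: log_ext_def)
  then have "(\<Sum>(k, a)\<in>runs - {(k, a)}. ereal (P k a) * log_ext (prob \<rho> k a)) \<noteq> \<infinity>"
    unfolding sum_Pinfty by auto
  moreover have "log_likelihood P \<rho> = ereal (P k a) * log_ext (prob \<rho> k a)
      + (\<Sum>(k, a)\<in>runs - {(k, a)}. ereal (P k a) * log_ext (prob \<rho> k a))"
    unfolding log_likelihood_runs using assms(1) by (subst sum.remove[OF finite_runs, of "(k, a)"]) auto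
  moreover have "ereal (P k a) * log_ext (prob \<rho> k a) = - \<infinity>"
    using assms by (simp add: log_ext_def)
  ultimately show ?thesis by simp
qed

lemma log_likelihood_ml:
  "log_likelihood P \<rho>\<^sub>0 = ereal (\<Sum>(k, a)\<in>runs. P k a * ln (prob \<rho>\<^sub>0 k a))"
  using ml_prob_pos by (rule log_likelihood_finite)

text \<open>For P > 0 the gap is P (x - 1 - ln x), with x the ratio of the two predicted
  probabilities. It is nonnegative and vanishes only at x = 1.\<close>

lemma likelihood_gap:
  assumes a: "a \<in> outcomes" and pos: "0 < P k a \<Longrightarrow> 0 < prob \<rho> k a"
  defines "gap \<equiv> P k a * (prob \<rho> k a / prob \<rho>\<^sub>0 k a) - P k a
    - (P k a * ln (prob \<rho> k a) - P k a * ln (prob \<rho>\<^sub>0 k a))"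
  shows "0 \<le> gap" and "gap = 0 \<Longrightarrow> 0 < P k a \<Longrightarrow> prob \<rho> k a = prob \<rho>\<^sub>0 k a"
proof -
  define x where "x = prob \<rho> k a / prob \<rho>\<^sub>0 k a"
  have x: "0 < x" "ln x = ln (prob \<rho> k a) - ln (prob \<rho>\<^sub>0 k a)" if "0 < P k a"
    using pos[OF that] ml_prob_pos[OF a that] by (auto simp: x_def ln_div)
  then have gap: "gap = P k a * (x - 1 - ln x)" if "0 < P k a"
    unfolding gap_def x(2)[OF that] x_def[symmetric] by (simp add: algebra_simps)
  show "0 \<le> gap"
  proof (cases "P k a = 0")
    case False
    then have Ppos: "0 < P k a" using data_nonneg[OF a, of k] by simp
    then show ?thesis
      unfolding gap[OF Ppos] using ln_le_minus_one[OF x(1)] by simp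
  qed (simp add: gap_def)
  assume "gap = 0" and Ppos: "0 < P k a"
  then have "ln x = x - 1" by (simp add: gap)
  then have "x = 1" using x(1)[OF Ppos] ln_eq_minus_one by blast
  then show "prob \<rho> k a = prob \<rho>\<^sub>0 k a"
    using ml_prob_pos[OF a Ppos] by (simp add: x_def)
qed

lemma log_likelihood_le_ml:
  assumes \<rho>: "density_mat \<rho>"
  shows "log_likelihood P \<rho> \<le> log_likelihood P \<rho>\<^sub>0"
    and "log_likelihood P \<rho> = log_likelihood P \<rho>\<^sub>0 \<Longrightarrow> a \<in> outcomes \<Longrightarrow> 0 < P k a \<Longrightarrow>
      prob \<rho> k a = prob \<rho>\<^sub>0 k a"
proof -
  define gap where "gap = (\<lambda>(k, a). P k a * (prob \<rho> k a / prob \<rho>\<^sub>0 k a) - P k a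
    - (P k a * ln (prob \<rho> k a) - P k a * ln (prob \<rho>\<^sub>0 k a)))"
  define \<Lambda> where "\<Lambda> \<sigma> = (\<Sum>(k, a)\<in>runs. P k a * ln (prob \<sigma> k a))" for \<sigma>
  have "(\<Sum>ka\<in>runs. gap ka) = (\<Sum>(k, a)\<in>runs. P k a * (prob \<rho> k a / prob \<rho>\<^sub>0 k a))
      - (\<Sum>(k, a)\<in>runs. P k a) - (\<Lambda> \<rho> - \<Lambda> \<rho>\<^sub>0)"
    by (simp add: gap_def \<Lambda>_def sum_subtractf case_prod_unfold)
  \<comment> \<open>The ratio sum is at most \<open>3 ^ CARD('n)\<close>, which is exactly the sum
    of the data.\<close>
  then have sum_le: "(\<Sum>ka\<in>runs. gap ka) \<le> \<Lambda> \<rho>\<^sub>0 - \<Lambda> \<rho>"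
    using likelihood_ratio_sum[OF \<rho>] data_sum by linarith
  have "log_likelihood P \<rho> \<le> log_likelihood P \<rho>\<^sub>0 \<and> (log_likelihood P \<rho> = log_likelihood P \<rho>\<^sub>0 \<longrightarrow>
      a \<in> outcomes \<longrightarrow> 0 < P k a \<longrightarrow> prob \<rho> k a = prob \<rho>\<^sub>0 k a)" for k a
  \<comment> \<open>If \<rho> excludes an outcome that occurs, its log-likelihood is - \<infinity>,
    strictly below the finite value at \<open>\<rho>\<^sub>0\<close>.\<close>
  proof (cases "\<forall>k. \<forall>a\<in>outcomes. 0 < P k a \<longrightarrow> 0 < prob \<rho> k a")
    case False
    then have "log_likelihood P \<rho> = - \<infinity>"
      using log_likelihood_infinite[of _ _ \<rho>] by (auto simp: not_less)
    then show ?thesis by (simp add: log_likelihood_ml)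
  next
    case True
    then have pos: "0 < prob \<rho> k a" if "a \<in> outcomes" "0 < P k a" for k a
      using that by blast
    from log_likelihood_finite[OF this] have fin: "log_likelihood P \<rho> = ereal (\<Lambda> \<rho>)"
      by (simp add: \<Lambda>_def)
    have gap: "0 \<le> gap ka" if "ka \<in> runs" for ka
      using that likelihood_gap(1)[OF _ pos] by (auto simp: gap_def)
    then have "0 \<le> (\<Sum>ka\<in>runs. gap ka)" by (rule sum_nonneg)
    moreover have "prob \<rho> k a = prob \<rho>\<^sub>0 k a" if "\<Lambda> \<rho> = \<Lambda> \<rho>\<^sub>0" "a \<in> outcomes" "0 < P k a"
    proof -
      have "(\<Sum>ka\<in>runs. gap ka) = 0" using sum_le that(1) calculation by simp
      then have "\<forall>ka\<in>runs. gap ka = 0"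
        using sum_nonneg_eq_0_iff[OF finite_runs gap] by simp
      then have "gap (k, a) = 0" using that(2) by blast
      then show ?thesis
        using likelihood_gap(2)[OF that(2) pos[OF that(2)] _ that(3)] by (simp add: gap_def)
    qed
    ultimately show ?thesis
      using sum_le by (auto simp: fin log_likelihood_ml \<Lambda>_def[symmetric])
  qed
  then show "log_likelihood P \<rho> \<le> log_likelihood P \<rho>\<^sub>0"
    "log_likelihood P \<rho> = log_likelihood P \<rho>\<^sub>0 \<Longrightarrow> a \<in> outcomes \<Longrightarrow> 0 < P k a \<Longrightarrow>
      prob \<rho> k a = prob \<rho>\<^sub>0 k a" by blast+
qed

lemma density_ml: "density_mat \<rho>\<^sub>0"
  using ml by (intro density_mat_tensor) (simp add: density_bloch_state_iff qubit_ml_def)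

lemma is_ml_state_tensor: "is_ml_state P \<rho>\<^sub>0"
  using log_likelihood_le_ml(1) density_ml by (simp add: is_ml_state_def)

text \<open>The difference D of two maximizers has zero trace against every projector of positive
  probability. Expanding matrix units in these projectors shows that every entry of D is 0.\<close>

lemma is_ml_state_unique:
  assumes random: "\<And>j. \<exists>k. \<bar>f j $ k\<bar> < 1" and "is_ml_state P \<rho>"
  shows "\<rho> = \<rho>\<^sub>0"
proof -
  define Q where "Q k a = tensor (\<lambda>j :: 'n. outcome_proj (a j) (pauli (k j)))" for k a
  have \<rho>: "density_mat \<rho>" and "log_likelihood P \<rho> = log_likelihood P \<rho>\<^sub>0"
    using assms(2) density_ml log_likelihood_le_ml(1) unfolding is_ml_state_def by (auto intro: antisym)
  note eq = log_likelihood_le_ml(2)[OF this]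
  define D where "D = \<rho> - \<rho>\<^sub>0"
  have D0: "trace (D ** Q k a) = 0" if "a \<in> outcomes" "0 < P k a" for k a
  proof -
    have "adjoint_mat (Q k a) = Q k a"
      by (simp add: Q_def adjoint_mat_tensor outcome_proj_pauli)
    then have "Im (trace (\<sigma> ** Q k a)) = 0" if "density_mat \<sigma>" for \<sigma>
      using that by (intro trace_hermitian_mult_real) (auto simp: density_mat_def psd_mat_def)
    then have "trace (\<rho> ** Q k a) = trace (\<rho>\<^sub>0 ** Q k a)"
      using eq[OF that] \<rho> density_ml by (simp add: complex_eq_iff outcome_prob_def Q_def)
    moreover have "D ** Q k a = \<rho> ** Q k a - \<rho>\<^sub>0 ** Q k a"
      by (simp add: D_def vec_eq_iff matrix_matrix_mult_def algebra_simps sum_subtractf)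
    ultimately show ?thesis by (simp add: trace_sub)
  qed
  have "D $ y $ x = 0" for x y
  proof -
    define E :: "'n \<Rightarrow> complex^2^2" where "E j = (\<chi> a b. if a = x j \<and> b = y j then 1 else 0)" for j
    have "\<forall>j. \<exists>c. E j = (\<Sum>k\<in>UNIV. \<Sum>a\<in>{1, - 1}. mat (c k a) ** outcome_proj a (pauli k)) \<and>
        (\<forall>k. \<forall>a\<in>{1, - 1}. 1 + a * f j $ k = 0 \<longrightarrow> c k a = 0)"
      using random outcome_proj_span by blast
    then obtain c where c: "\<And>j. E j = (\<Sum>k\<in>UNIV. \<Sum>a\<in>{1, - 1}. mat (c j k a) ** outcome_proj a (pauli k))"
      and c0: "\<And>j k a. a \<in> {1, - 1} \<Longrightarrow> 1 + a * f j $ k = 0 \<Longrightarrow> c j k a = 0"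
      by (subst (asm) choice_iff) blast
    have "D $ y $ x = trace (D ** tensor E)"
      unfolding E_def by (rule trace_tensor_mult_axis[symmetric])
    also have "\<dots> = (\<Sum>k\<in>UNIV. \<Sum>a\<in>outcomes. (\<Prod>j\<in>UNIV. c j (k j) (a j)) * trace (D ** Q k a))"
      unfolding Q_def c by (rule trace_tensor_sum_outcomes)
    also have "\<dots> = 0"
    proof (intro sum.neutral ballI)
      fix k a assume a: "a \<in> (outcomes :: ('n \<Rightarrow> real) set)"
      show "(\<Prod>j\<in>UNIV. c j (k j) (a j)) * trace (D ** Q k a) = 0"
      \<comment> \<open>A vanishing datum has a vanishing factor at some qubit, and there the
        coefficient was chosen to be 0.\<close>
      proof (cases "P k a = 0")
        case True
        then obtain j where "1 + a j * f j $ k j = 0" by (auto simp: P)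
        moreover have "a j \<in> {1, - 1}" using a by (auto simp: outcomes_def)
        ultimately have "c j (k j) (a j) = 0" by (intro c0)
        then have "(\<Prod>j\<in>UNIV. c j (k j) (a j)) = 0" by (intro prod_zero) auto
        then show ?thesis by simp
      next
        case False
        then show ?thesis using D0[OF a, of k] data_nonneg[OF a, of k] by simp
      qed
    qed
    finally show ?thesis .
  qed
  then show ?thesis by (simp add: D_def vec_eq_iff)
qed

end

section \<open>The reconstructed state\<close>

text \<open>If all three outcomes were certain, every squared component of t would be at least 2/3,
  and the squared norm of t at least 2.\<close>

lemma exists_random_setting:
  fixes t :: "real^3" and n :: "3 \<Rightarrow> real^3"
  assumes n: "\<And>k. norm (n k) = 1" "\<And>k. c \<le> n k $ k"
    and c: "0 \<le> c" "2 / 3 \<le> c\<^sup>2" and s: "0 \<le> s" "c\<^sup>2 + s\<^sup>2 = 1"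
    and t: "norm t \<le> 1"
  shows "\<exists>k. \<bar>n k \<bullet> t\<bar> < 1"
proof (rule ccontr)
  assume none: "\<nexists>k. \<bar>n k \<bullet> t\<bar> < 1"
  have t2: "(norm t)\<^sup>2 \<le> 1" using t by (simp add: power_le_one)
  have "2 / 3 \<le> (t $ k)\<^sup>2" for k
  proof -
    have "\<bar>n k \<bullet> t\<bar> \<le> 1"
      using Cauchy_Schwarz_ineq2[of "n k" t] n(1)[of k] t by simp
    then have f: "\<bar>n k \<bullet> t\<bar> = 1" using none by (simp add: not_less order_antisym)
    then have "(n k \<bullet> t)\<^sup>2 = 1" by (metis power2_abs one_power2)
    moreover from this have "(norm t)\<^sup>2 = 1"
      using Cauchy_Schwarz_ineq2[of "n k" t] n(1)[of k] f t by simp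
    \<comment> \<open>With \<open>norm t = 1\<close> and a deterministic outcome the square root
      term vanishes.\<close>
    ultimately have "c \<le> (n k \<bullet> t) * (t $ k)"
      using unit_vectors_inner_bound[of "n k" "axis k 1" c s t] n c s by (simp add: inner_axis inner_axis')
    then have "c\<^sup>2 \<le> ((n k \<bullet> t) * (t $ k))\<^sup>2" using c(1) by (rule power_mono)
    then show ?thesis using c(2) \<open>(n k \<bullet> t)\<^sup>2 = 1\<close> by (simp add: power_mult_distrib)
  qed
  from this[of 1] this[of 2] this[of 3] show False
    using t2 unfolding norm_vec3 by linarith
qed

text \<open>Collects what both the bound and its saturation use. The equivalence contains existence
  and uniqueness; outside the ball only the Lagrange inequality for r is retained, as the bound
  requires no more.\<close>

lemma ml_reconstruction:
  fixes t :: "'n::finite \<Rightarrow> real^3" and n :: "'n \<Rightarrow> 3 \<Rightarrow> real^3"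
  assumes n: "\<And>j k. norm (n j k) = 1" "\<And>j k. c \<le> n j k $ k"
    and c: "0 \<le> c" "2 / 3 \<le> c\<^sup>2" and s: "0 \<le> s" "c\<^sup>2 + s\<^sup>2 = 1"
    and t: "\<And>j. norm (t j) \<le> 1"
  defines "f \<equiv> \<lambda>j. \<chi> k. n j k \<bullet> t j"
  shows "\<exists>r. (\<forall>j. norm (r j) \<le> 1 \<and> (norm (f j) \<le> 1 \<longrightarrow> r j = f j) \<and>
      (norm (f j) > 1 \<longrightarrow> norm (r j) = 1 \<and> (\<forall>k. (r j $ k)\<^sup>2 \<le> r j $ k * f j $ k))) \<and>
    (\<forall>\<rho>. is_ml_state (measured_data n (tensor (\<lambda>j. bloch_state (t j)))) \<rho> \<longleftrightarrow>
      \<rho> = tensor (\<lambda>j. bloch_state (r j)))"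
proof -
  have f: "\<bar>f j $ k\<bar> \<le> 1" for j k
    using Cauchy_Schwarz_ineq2[of "n j k" "t j"] n(1)[of j k] t[of j] by (simp add: f_def)
  have "\<exists>r. qubit_ml (f j) r \<and> (norm (f j) \<le> 1 \<longrightarrow> r = f j)" for j
    using qubit_ml_self qubit_ml_exists[OF f] by (cases "norm (f j) \<le> 1") auto
  then obtain r where r: "\<And>j. qubit_ml (f j) (r j)" "\<And>j. norm (f j) \<le> 1 \<Longrightarrow> r j = f j"
    by metis
  have data: "measured_data n (tensor (\<lambda>j. bloch_state (t j))) k a = (\<Prod>j\<in>UNIV. (1 + a j * f j $ k j) / 2)" for k a
    by (simp add: measured_data_def outcome_prob_tensor_bloch f_def)
  have "\<exists>k. \<bar>f j $ k\<bar> < 1" for j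
    using exists_random_setting[OF n c s t] by (simp add: f_def)
  note unique = is_ml_state_unique[of f r, OF f r(1) data this]
  note ml = is_ml_state_tensor[of f r, OF f r(1) data]
  show ?thesis
  proof (intro exI[of _ r] conjI allI impI)
    fix j
    show "norm (r j) \<le> 1" using r(1)[of j] by (simp add: qubit_ml_def)
    show "r j = f j" if "norm (f j) \<le> 1" using r(2)[OF that] .
    show "norm (r j) = 1" "(r j $ k)\<^sup>2 \<le> r j $ k * f j $ k" if "norm (f j) > 1" for k
      using qubit_ml_outside[OF f r(1) that] by auto
  next
    fix \<rho>
    show "is_ml_state (measured_data n (tensor (\<lambda>j. bloch_state (t j)))) \<rho> \<longleftrightarrow>
        \<rho> = tensor (\<lambda>j. bloch_state (r j))"
      using unique ml by blast
  qed
qed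

lemma fidelity_tensor_bloch:
  fixes t r :: "'n::finite \<Rightarrow> real^3"
  assumes "\<And>j. norm (t j) \<le> 1" "\<And>j. norm (r j) \<le> 1"
  shows "fidelity (tensor (\<lambda>j. bloch_state (t j))) (tensor (\<lambda>j. bloch_state (r j)))
    = (\<Prod>j\<in>UNIV. (1 + t j \<bullet> r j + sqrt ((1 - (norm (t j))\<^sup>2) * (1 - (norm (r j))\<^sup>2))) / 2)"
proof -
  have psd: "psd_mat (bloch_state v)" if "norm v \<le> 1" for v
    using that density_bloch_state_iff unfolding density_mat_def by blast
  have "fidelity (tensor (\<lambda>j. bloch_state (t j))) (tensor (\<lambda>j. bloch_state (r j)))
      = (\<Prod>j\<in>UNIV. fidelity (bloch_state (t j)) (bloch_state (r j)))"
    by (rule fidelity_tensor) (auto intro: psd assms)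
  then show ?thesis by (simp add: fidelity_bloch_state assms)
qed

section \<open>The derivative of the bound\<close>

lemma fid_bound_n_has_derivative:
  "(fid_bound_n n has_real_derivative
    real n * fid_bound e ^ (n - 1) * ((1 / 2) * (- sin e - sqrt 2 * cos e))) (at e)"
proof -
  have "(fid_bound has_real_derivative (1 / 2) * (- sin e - sqrt 2 * cos e)) (at e)"
    unfolding fid_bound_def[abs_def] by (auto intro!: derivative_eq_intros simp: field_simps)
  from DERIV_power[OF this, of n] show ?thesis
    by (simp add: fid_bound_n_def[abs_def] mult_ac)
qed

lemma fid_bound_n_derivative_0:
  "real n * fid_bound 0 ^ (n - 1) * ((1 / 2) * (- sin 0 - sqrt 2 * cos 0)) = - (real n / sqrt 2)"
proof -
  have "sqrt 2 / 2 = 1 / sqrt 2" by (simp add: field_simps)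
  then show ?thesis by (simp add: fid_bound_def field_simps)
qed

theorem mainTheorem2:
  fixes \<epsilon> :: real
  assumes "0 \<le> \<epsilon>" and "\<epsilon> \<le> arccos (sqrt (2 / 3))"
  shows
    "(\<forall>(\<tau> :: 'n::finite \<Rightarrow> complex^2^2) (nhat :: 'n \<Rightarrow> 3 \<Rightarrow> real^3).
        (\<forall>j. density_mat (\<tau> j)) \<and>
        (\<forall>j k. norm (nhat j k) = 1 \<and> nhat j k \<bullet> axis k 1 \<ge> cos \<epsilon>) \<longrightarrow>
        (\<exists>!\<rho>. is_ml_state (measured_data nhat (tensor \<tau>)) \<rho>) \<and>
        (\<forall>\<rho>. is_ml_state (measured_data nhat (tensor \<tau>)) \<rho> \<longrightarrow>
           fidelity (tensor \<tau>) \<rho> \<ge> fid_bound_n CARD('n) \<epsilon>))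
     \<and>
     (\<forall>(\<tau> :: 'n \<Rightarrow> complex^2^2) (nhat :: 'n \<Rightarrow> 3 \<Rightarrow> real^3).
        (\<forall>j. \<tau> j = bloch_state ((1 / sqrt 3) *\<^sub>R vector [1, 1, 1])) \<and>
        (\<forall>j. nhat j 1 = vector [cos \<epsilon>, - (sin \<epsilon> / sqrt 2), - (sin \<epsilon> / sqrt 2)] \<and>
             nhat j 2 = vector [- (sin \<epsilon> / sqrt 2), cos \<epsilon>, - (sin \<epsilon> / sqrt 2)] \<and>
             nhat j 3 = vector [- (sin \<epsilon> / sqrt 2), - (sin \<epsilon> / sqrt 2), cos \<epsilon>]) \<longrightarrow>
        (\<exists>!\<rho>. is_ml_state (measured_data nhat (tensor \<tau>)) \<rho>) \<and>
        (\<forall>\<rho>. is_ml_state (measured_data nhat (tensor \<tau>)) \<rho> \<longrightarrow>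
           fidelity (tensor \<tau>) \<rho> = fid_bound_n CARD('n) \<epsilon>))
     \<and>
     (fid_bound_n CARD('n) has_real_derivative - (real CARD('n) / sqrt 2)) (at 0)
     \<and>
     (deriv (fid_bound_n CARD('n)) \<longlongrightarrow> - (real CARD('n) / sqrt 2)) (at 0)"
proof -
  have "sqrt (2 / 3) \<le> 1" "0 \<le> sqrt (2 / 3)" by simp_all
  then have sq: "- 1 \<le> sqrt (2 / 3)" "sqrt (2 / 3) \<le> 1" by linarith+
  have "cos (arccos (sqrt (2 / 3))) \<le> cos \<epsilon>"
    using assms arccos_ubound[OF sq] by (intro cos_monotone_0_pi_le) auto
  then have ce: "sqrt (2 / 3) \<le> cos \<epsilon>"
    by (simp only: cos_arccos[OF sq])
  have c: "0 \<le> cos \<epsilon>" using ce by (rule order_trans[rotated]) simp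
  have "(sqrt (2 / 3))\<^sup>2 \<le> (cos \<epsilon>)\<^sup>2" using ce by (intro power_mono) simp_all
  then have c2: "2 / 3 \<le> (cos \<epsilon>)\<^sup>2" by simp
  have "\<epsilon> \<le> pi" using assms(2) arccos_ubound[OF sq] by linarith
  then have s: "0 \<le> sin \<epsilon>" using assms(1) by (rule sin_ge_zero[rotated])
  have cs: "(cos \<epsilon>)\<^sup>2 + (sin \<epsilon>)\<^sup>2 = 1" by simp
  define m where "m = cos \<epsilon> - sqrt 2 * sin \<epsilon>"
  have fb: "fid_bound \<epsilon> = (1 + m) / 2" by (simp add: fid_bound_def m_def)
  \<comment> \<open>From the lower bound 2/3 on the squared cosine. It leads to m between -1 and 1,
    so that \<open>fid_bound \<epsilon>\<close> is nonnegative, as comparing products needs, and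
    \<open>m *\<^sub>R t\<close> stays in the ball.\<close>
  have "(sqrt 2 * sin \<epsilon>)\<^sup>2 \<le> 1\<^sup>2"
    using c2 by (simp add: power_mult_distrib sin_squared_eq)
  then have "sqrt 2 * sin \<epsilon> \<le> 1" by (rule power2_le_imp_le) simp
  moreover have "0 \<le> sqrt 2 * sin \<epsilon>" using s by simp
  ultimately have m: "- 1 \<le> m" "m \<le> 1"
    unfolding m_def using c cos_le_one[of \<epsilon>] by linarith+
  have bound: "(\<exists>!\<rho>. is_ml_state (measured_data nhat (tensor \<tau>)) \<rho>) \<and>
      (\<forall>\<rho>. is_ml_state (measured_data nhat (tensor \<tau>)) \<rho> \<longrightarrow> fidelity (tensor \<tau>) \<rho> \<ge> fid_bound_n CARD('n) \<epsilon>)"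
    if \<tau>: "\<forall>j. density_mat (\<tau> j)" and nhat: "\<forall>j k. norm (nhat j k) = 1 \<and> nhat j k \<bullet> axis k 1 \<ge> cos \<epsilon>"
    for \<tau> :: "'n \<Rightarrow> complex^2^2" and nhat :: "'n \<Rightarrow> 3 \<Rightarrow> real^3"
  proof -
    have n: "norm (nhat j k) = 1" "cos \<epsilon> \<le> nhat j k $ k" for j k
      using nhat by (auto simp: inner_axis)
    have "\<forall>j. \<exists>t. \<tau> j = bloch_state t \<and> norm t \<le> 1"
      using \<tau> density_mat_imp_bloch_state by metis
    then obtain t where "\<And>j. \<tau> j = bloch_state (t j)" and t: "\<And>j. norm (t j) \<le> 1"
      by metis
    then have \<tau>t: "\<tau> = (\<lambda>j. bloch_state (t j))" by auto
    from ml_reconstruction[where n = nhat and t = t, OF n c c2 s cs t] obtain r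
      where r: "\<And>j. norm (r j) \<le> 1"
        "\<And>j. norm (\<chi> k. nhat j k \<bullet> t j) \<le> 1 \<Longrightarrow> r j = (\<chi> k. nhat j k \<bullet> t j)"
        "\<And>j. norm (\<chi> k. nhat j k \<bullet> t j) > 1 \<Longrightarrow> norm (r j) = 1 \<and>
          (\<forall>k. (r j $ k)\<^sup>2 \<le> r j $ k * (\<chi> k. nhat j k \<bullet> t j) $ k)"
      and ml: "\<And>\<rho>. is_ml_state (measured_data nhat (tensor \<tau>)) \<rho> \<longleftrightarrow> \<rho> = tensor (\<lambda>j. bloch_state (r j))"
      unfolding \<tau>t by blast
    have "(\<Prod>j\<in>(UNIV :: 'n set). fid_bound \<epsilon>) \<le> fidelity (tensor \<tau>) (tensor (\<lambda>j. bloch_state (r j)))"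
      unfolding \<tau>t fidelity_tensor_bloch[OF t r(1)]
    proof (intro prod_mono conjI)
      fix j
      show "0 \<le> fid_bound \<epsilon>" using m by (simp add: fb)
      have "m \<le> t j \<bullet> r j + sqrt ((1 - (norm (t j))\<^sup>2) * (1 - (norm (r j))\<^sup>2))"
        unfolding m_def by (rule qubit_fidelity_bound[where n = "nhat j", OF n c s cs t refl]) (use r(2,3) in blast)+
      then show "fid_bound \<epsilon> \<le> (1 + t j \<bullet> r j + sqrt ((1 - (norm (t j))\<^sup>2) * (1 - (norm (r j))\<^sup>2))) / 2"
        by (simp add: fb)
    qed
    then show ?thesis by (auto simp: ml fid_bound_n_def)
  qed
  have saturated: "(\<exists>!\<rho>. is_ml_state (measured_data nhat (tensor \<tau>)) \<rho>) \<and>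
      (\<forall>\<rho>. is_ml_state (measured_data nhat (tensor \<tau>)) \<rho> \<longrightarrow> fidelity (tensor \<tau>) \<rho> = fid_bound_n CARD('n) \<epsilon>)"
    if \<tau>: "\<forall>j. \<tau> j = bloch_state ((1 / sqrt 3) *\<^sub>R vector [1, 1, 1])"
      and nhat: "\<forall>j. nhat j 1 = vector [cos \<epsilon>, - (sin \<epsilon> / sqrt 2), - (sin \<epsilon> / sqrt 2)] \<and>
             nhat j 2 = vector [- (sin \<epsilon> / sqrt 2), cos \<epsilon>, - (sin \<epsilon> / sqrt 2)] \<and>
             nhat j 3 = vector [- (sin \<epsilon> / sqrt 2), - (sin \<epsilon> / sqrt 2), cos \<epsilon>]"
    for \<tau> :: "'n \<Rightarrow> complex^2^2" and nhat :: "'n \<Rightarrow> 3 \<Rightarrow> real^3"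
  proof -
    define t :: "real^3" where "t = (1 / sqrt 3) *\<^sub>R vector [1, 1, 1]"
    have \<tau>t: "\<tau> = (\<lambda>j. bloch_state t)" using \<tau> by (auto simp: t_def)
    have t2: "(norm t)\<^sup>2 = 1" unfolding norm_vec3 by (simp add: t_def power_divide)
    then have t1: "norm t = 1" using norm_ge_zero[of t] by (simp add: power2_eq_1_iff)
    have "(norm (nhat j k))\<^sup>2 = 1" for j k
      using nhat[rule_format, of j] exhaust_3[of k] cs unfolding norm_vec3
      by (auto simp: power_divide)
    then have n1: "norm (nhat j k) = 1" for j k
      by (metis norm_ge_zero power2_eq_1_iff neg_0_le_iff_le not_one_le_zero)
    have n2: "cos \<epsilon> \<le> nhat j k $ k" for j k
      using nhat[rule_format, of j] exhaust_3[of k] by auto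
    \<comment> \<open>Each datum is (cos \<epsilon> - 2 sin \<epsilon> / sqrt 2) / sqrt 3, so the
      imperfect measurements merely scale t by m. The data lie in the ball and are reproduced
      exactly.\<close>
    have f: "(\<chi> k. nhat j k \<bullet> t) = m *\<^sub>R t" for j
    proof -
      have "2 * sin \<epsilon> / (sqrt 2 * sqrt 3) = sqrt 2 * sin \<epsilon> / sqrt 3"
        by (simp add: field_simps)
      then show ?thesis
        using nhat[rule_format, of j]
        by (simp add: vec_eq_iff forall_3 inner_vec3 t_def m_def diff_divide_distrib)
    qed
    then have "norm (\<chi> k. nhat j k \<bullet> t) \<le> 1" for j
      using m by (simp add: t1)
    moreover from ml_reconstruction[where n = nhat and t = "\<lambda>_. t", OF n1 n2 c c2 s cs] t1 obtain r
      where "\<And>j. norm (\<chi> k. nhat j k \<bullet> t) \<le> 1 \<Longrightarrow> r j = (\<chi> k. nhat j k \<bullet> t)"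
        and ml: "\<And>\<rho>. is_ml_state (measured_data nhat (tensor \<tau>)) \<rho> \<longleftrightarrow> \<rho> = tensor (\<lambda>j. bloch_state (r j))"
      unfolding \<tau>t by auto
    ultimately have "r = (\<lambda>j. m *\<^sub>R t)" by (auto simp: f)
    \<comment> \<open>As t is a unit vector, the square root term vanishes and each factor is (1 +
      m) / 2.\<close>
    moreover have "fidelity (tensor \<tau>) (tensor (\<lambda>j :: 'n. bloch_state (m *\<^sub>R t))) = fid_bound_n CARD('n) \<epsilon>"
      unfolding \<tau>t using m
      by (subst fidelity_tensor_bloch) (auto simp: t1 fid_bound_n_def fb dot_square_norm)
    ultimately show ?thesis using ml by auto
  qed
  have D: "(fid_bound_n CARD('n) has_real_derivative - (real CARD('n) / sqrt 2)) (at 0)"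
    using fid_bound_n_has_derivative[of "CARD('n)" 0] unfolding fid_bound_n_derivative_0 .
  \<comment> \<open>The derivative formula holds everywhere and is continuous, so its limit at 0 is
    its value there.\<close>
  have "deriv (fid_bound_n CARD('n))
      = (\<lambda>e. real CARD('n) * fid_bound e ^ (CARD('n) - 1) * ((1 / 2) * (- sin e - sqrt 2 * cos e)))"
    by (rule ext) (rule DERIV_imp_deriv[OF fid_bound_n_has_derivative])
  moreover have "isCont (\<lambda>e. real CARD('n) * fid_bound e ^ (CARD('n) - 1) * ((1 / 2) * (- sin e - sqrt 2 * cos e))) 0"
    unfolding fid_bound_def by (intro continuous_intros)
  ultimately have L: "(deriv (fid_bound_n CARD('n)) \<longlongrightarrow> - (real CARD('n) / sqrt 2)) (at 0)"
    unfolding isCont_def fid_bound_n_derivative_0 by simp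
  show ?thesis
    apply (intro conjI[OF _ conjI[OF _ conjI[OF D L]]] allI impI; erule conjE)
     apply (rule bound; assumption)
    apply (rule saturated; assumption)
    done
qed

end
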